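(* Let $\Phi$ be a (finite) CHC problem, i.e., a finite set of linear constrained Horn clauses over $\Sigma$ and $\mathcal{A}$, and let $\leadsto_{rs}$ be the ADCL transition relation restricted by a reasonable strategy. If $\Phi$ is unsatisfiable, then $\Phi\leadsto_{rs}^*\mathsf{unsat}$ (i.e., there is a derivation from $\Phi$ to $\mathsf{unsat}$ that complies with the conditions of a reasonable strategy).
   Context: **Clauses.** $\Sigma$ is a many-sorted signature containing only predicate symbols; $\mathcal{A}$ is a complete first-order theory with equality over a many-sorted signature $\Sigma_{\mathcal{A}}$ disjoint from $\Sigma$; $\mathcal{V}$ is a countably infinite set of variables; $\mathsf{QF}(\mathcal{A})$ is the set of quantifier-free first-order formulas over $\Sigma_{\mathcal{A}}$. A (linear) CHC is a universally closed formula of one of the forms $\psi \Rightarrow G(\vec Y)$ (fact), $F(\vec X)\wedge\psi\Rightarrow G(\vec Y)$ (rule), $F(\vec X)\wedge \psi\Rightarrow\bot$ (query), $\psi\Rightarrow\bot$ (conditional empty clause), where $F,G\in\Sigma$, $\vec X,\vec Y$ are disjoint vectors of pairwise different variables, and $\psi\in\mathsf{QF}(\mathcal{A})$ is in negation normal form and may contain further variables. We uniformly write $\eta\wedge\psi\Rightarrow\eta'$, with $\eta=\top$ if there is no body atom and $\eta'=\bot$ if there is no head atom. The condition is $\mathsf{cond}(\eta\wedge\psi\Rightarrow\eta')=\psi$; $\varphi|_{\psi'}$ is $\varphi$ with its condition replaced by $\psi'$. A CHC is recursive if it is a rule with $F=G$, and conjunctive if $\psi$ is a conjunction of literals (conjunctions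 are identified with sets of literals). A CHC problem is a finite set of CHCs. Clauses are considered up to renaming of variables. **Semantics.** An $\mathcal{A}$-interpretation is a model of $\mathcal{A}$ whose carrier only contains ground terms over $\Sigma_{\mathcal{A}}$, extended with interpretations for $\Sigma$ and $\mathcal{V}$; by completeness of $\mathcal{A}$, $\mathcal{A}$-interpretations are regarded as differing only on $\Sigma$ and $\mathcal{V}$. $\sigma\models_{\mathcal{A}}\eta$ means that the $\mathcal{A}$-interpretation $\sigma$ satisfies $\eta$; a formula or set of formulas is satisfiable if some $\mathcal{A}$-interpretation satisfies it (all of it). The ground instances are $\mathsf{grnd}(\eta\wedge\psi\Rightarrow\eta')=\{\eta\sigma\Rightarrow\eta'\sigma\mid\sigma\models_{\mathcal{A}}\psi\}$, where $\eta\sigma$ instantiates the variables of $\eta$ according to $\sigma$. **Resolution.** For variable-disjoint (after renaming) $\varphi=(\eta\wedge\psi\Rightarrow F(\vec x))$ and $\varphi'=(F(\vec y)\wedge\psi'\Rightarrow\eta')$ with $\theta=\mathrm{mgu}(F(\vec x),F(\vec y))$, let $\mathsf{res}(\varphi,\varphi')=(\eta\wedge\psi\wedge\psi'\Rightarrow\eta')\theta$; in all other cases $\mathsf{res}(\varphi,\varphi')=(\bot\Rightarrow\bot)$. For non-empty sequences: $\mathsf{res}([\varphi_1])=\varphi_1$, $\mathsf{res}([\varphi_1,\varphi_2]::\vec\varphi)=\mathsf{res}(\mathsf{res}(\varphi_1,\varphi_2)::\vec\varphi)$, where $::$ is concatenation (single elements are identified with sequences of length 1). Notions for CHCs are lifted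 to sequences via $\mathsf{res}$, e.g. $\mathsf{cond}(\vec\varphi)=\mathsf{cond}(\mathsf{res}(\vec\varphi))$, $\mathsf{grnd}(\vec\varphi)=\mathsf{grnd}(\mathsf{res}(\vec\varphi))$, and $\vec\varphi$ is recursive if $\mathsf{res}(\vec\varphi)$ is. A refutation is a (sequence whose resolvent is a) conditional empty clause with satisfiable condition. **Acceleration.** $\mathsf{accel}$ is a fixed acceleration technique: a function mapping each recursive conjunctive CHC $\varphi$ to a recursive conjunctive CHC with $\mathsf{grnd}(\mathsf{accel}(\varphi))=\bigcup_{n\ge1}\mathsf{grnd}(\varphi^n)$, where $\varphi^n$ is the sequence of $n$ copies of $\varphi$; $\mathcal{A}$ is taken rich enough to express the resulting clauses. $\mathsf{accel}(\vec\varphi)$ means $\mathsf{accel}(\mathsf{res}(\vec\varphi))$. **Syntactic implicants.** For $\sigma\models_{\mathcal{A}}\psi$ let $\mathsf{sip}(\psi,\sigma)=\bigwedge\{\ell \text{ literal of }\psi\mid\sigma\models_{\mathcal{A}}\ell\}$; $\mathsf{sip}(\psi)=\{\mathsf{sip}(\psi,\sigma)\mid\sigma\models_{\mathcal{A}}\psi\}$; $\mathsf{sip}(\varphi)=\{\varphi|_\psi\mid\psi\in\mathsf{sip}(\mathsf{cond}(\varphi))\}$; $\mathsf{sip}(\Pi)=\bigcup_{\varphi\in\Pi}\mathsf{sip}(\varphi)$. **Redundancy.** $\varphi\sqsubseteq\pi$ iff $\mathsf{grnd}(\varphi)\subseteq\mathsf{grnd}(\pi)$; $\varphi\sqsubset\pi$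 iff $\mathsf{grnd}(\varphi)\subsetneq\mathsf{grnd}(\pi)$; for a set $\Pi$, $\varphi\sqsubseteq\Pi$ (resp. $\varphi\sqsubset\Pi$) iff $\varphi\sqsubseteq\pi$ (resp. $\varphi\sqsubset\pi$) for some $\pi\in\Pi$. "Redundant w.r.t. $\Pi$" means $\sqsubseteq\Pi$. **ADCL.** Fix the original CHC problem $\Phi$. A state is a triple $(\Pi,[\varphi_i]_{i=1}^k,[B_i]_{i=0}^k)$ with $\Pi\supseteq\Phi$ a CHC problem, $[\varphi_i]_{i=1}^k\in\mathsf{sip}(\Pi)^*$ (the trace), $B_i\subseteq\mathsf{sip}(\Pi)$. In such a state, a clause $\varphi$ is blocked if $\varphi\sqsubseteq B_k$, and active if it is not blocked and $\mathsf{cond}([\varphi_i]_{i=1}^k::\varphi)$ is satisfiable; otherwise it is inactive. Let $\mathsf{bt}(\Pi,[\varphi_i]_{i=1}^k,[B_0,\dots,B_k])=(\Pi,[\varphi_i]_{i=1}^{k-1},[B_0,\dots,B_{k-2},B_{k-1}\cup\{\varphi_k\}])$. The relation $\leadsto$ is given by: - Init: $\Phi\leadsto(\Phi,[],[\emptyset])$. - Step: $(\Pi,\vec\varphi,\vec B)\leadsto(\Pi,\vec\varphi::\varphi,\vec B::\emptyset)$ if $\varphi\in\mathsf{sip}(\Pi)$ is active. - Accelerate: $(\Pi,\vec\varphi::\vec\varphi^\circ,\vec B::\vec B^\circ)\leadsto(\Pi\cup\{\varphi\},\vec\varphi::\varphi,\vec B::\{\varphi\})$ if $\vec\varphi^\circ$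 is recursive, $|\vec\varphi^\circ|=|\vec B^\circ|$, $\mathsf{accel}(\vec\varphi^\circ)=\varphi$. - Covered: $s=(\Pi,\vec\varphi::\vec\varphi',\vec B)\leadsto\mathsf{bt}(s)$ if $\vec\varphi'\sqsubset\mathsf{sip}(\Pi)$, or $\vec\varphi'\sqsubseteq\mathsf{sip}(\Pi)$ and $|\vec\varphi'|>1$ (with $\vec\varphi'$ non-empty). - Backtrack: $s=(\Pi,\vec\varphi::\varphi,\vec B)\leadsto\mathsf{bt}(s)$ if all rules and queries from $\mathsf{sip}(\Pi)$ are inactive and $\varphi$ is not a query. - Refute: $(\Pi,\vec\varphi,\vec B)\leadsto\mathsf{unsat}$ if $\vec\varphi$ is a refutation. - Prove: $(\Pi,[],[B])\leadsto\mathsf{sat}$ if all facts and conditional empty clauses from $\mathsf{sip}(\Pi)$ are inactive. **Reasonable strategy.** A strategy for $\leadsto$ is reasonable if: (1) if $(\Pi,\vec\varphi,\vec B)\leadsto^+(\Pi,\vec\varphi::\vec\varphi',\vec B')$ (a part of the derivation so far, with the same clause set $\Pi$ at both ends) for some $\vec\varphi'$ as in the definition of Covered (i.e. $\vec\varphi'\sqsubset\mathsf{sip}(\Pi)$, or $\vec\varphi'\sqsubseteq\mathsf{sip}(\Pi)$ and $|\vec\varphi'|>1$), then Covered is used; (2) Accelerate is used with higher preference than Step; (3) Accelerate is only applied to the shortest recursive suffix $\vec\varphi^\circ$ of the trace such that $\mathsf{accel}(\vec\varphi^\circ)$ is not redundant w.r.t. $\mathsf{sip}(\Pi)$; (4)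 if the trace is empty, then Step is only applied with facts or conditional empty clauses. $\leadsto_{rs}$ is the relation resulting from $\leadsto$ by imposing these restrictions (the remaining choices stay nondeterministic). *)

theory Defs
  imports Main "HOL-Library.Countable"
begin

section \<open>Many-sorted first-order logic\<close>

text \<open>
  A signature is given by partial arity functions; a symbol belongs to the signature iff its arity
  is defined. Since background symbols and the predicates of the clauses are taken from different
  types, the two signatures are disjoint. Sorts are countable, so that the set of all variables
  is countably infinite; there are infinitely many variables of each sort.
\<close>

record ('f, 'r, 's) signature =
  fun_arity :: "'f \<rightharpoonup> 's list \<times> 's"
  rel_arity :: "'r \<rightharpoonup> 's list"

type_synonym 's var = "nat \<times> 's"

abbreviation sort_of :: "'s var \<Rightarrow> 's" where
  "sort_of \<equiv> snd"

datatype (dead 'f, vars_trm: 'v) trm =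
    Var 'v
  | Fun 'f "('f, 'v) trm list"
for map: rename_trm

text \<open>
  The renaming function generated for formulas also renames bound variables; it is only
  applied to quantifier-free formulas.
\<close>

datatype (dead 'f, dead 'r, vars_fm: 'v) fm =
    Top
  | Bot
  | Eq "('f, 'v) trm" "('f, 'v) trm"
  | Rel 'r "('f, 'v) trm list"
  | Neg "('f, 'r, 'v) fm"
  | And "('f, 'r, 'v) fm" "('f, 'r, 'v) fm"
  | Or "('f, 'r, 'v) fm" "('f, 'r, 'v) fm"
  | Ex 'v "('f, 'r, 'v) fm"
  | All 'v "('f, 'r, 'v) fm"
for map: rename_fm

inductive has_sort :: "('f, 'r, 's) signature \<Rightarrow> ('f, 's var) trm \<Rightarrow> 's \<Rightarrow> bool" for S where
  "has_sort S (Var x) (sort_of x)"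
| "fun_arity S f = Some (ss, s) \<Longrightarrow> list_all2 (has_sort S) ts ss \<Longrightarrow> has_sort S (Fun f ts) s"

fun well_sorted :: "('f, 'r, 's) signature \<Rightarrow> ('f, 'r, 's var) fm \<Rightarrow> bool" where
  "well_sorted S Top \<longleftrightarrow> True"
| "well_sorted S Bot \<longleftrightarrow> True"
| "well_sorted S (Eq t u) \<longleftrightarrow> (\<exists>s. has_sort S t s \<and> has_sort S u s)"
| "well_sorted S (Rel r ts) \<longleftrightarrow> (\<exists>ss. rel_arity S r = Some ss \<and> list_all2 (has_sort S) ts ss)"
| "well_sorted S (Neg \<phi>) \<longleftrightarrow> well_sorted S \<phi>"
| "well_sorted S (And \<phi> \<psi>) \<longleftrightarrow> well_sorted S \<phi> \<and> well_sorted S \<psi>"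
| "well_sorted S (Or \<phi> \<psi>) \<longleftrightarrow> well_sorted S \<phi> \<and> well_sorted S \<psi>"
| "well_sorted S (Ex x \<phi>) \<longleftrightarrow> well_sorted S \<phi>"
| "well_sorted S (All x \<phi>) \<longleftrightarrow> well_sorted S \<phi>"

fun free_vars :: "('f, 'r, 'v) fm \<Rightarrow> 'v set" where
  "free_vars Top = {}"
| "free_vars Bot = {}"
| "free_vars (Eq t u) = vars_trm t \<union> vars_trm u"
| "free_vars (Rel r ts) = (\<Union>t\<in>set ts. vars_trm t)"
| "free_vars (Neg \<phi>) = free_vars \<phi>"
| "free_vars (And \<phi> \<psi>) = free_vars \<phi> \<union> free_vars \<psi>"
| "free_vars (Or \<phi> \<psi>) = free_vars \<phi> \<union> free_vars \<psi>"
| "free_vars (Ex x \<phi>) = free_vars \<phi> - {x}"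
| "free_vars (All x \<phi>) = free_vars \<phi> - {x}"

definition is_sentence :: "('f, 'r, 's) signature \<Rightarrow> ('f, 'r, 's var) fm \<Rightarrow> bool" where
  "is_sentence S \<phi> \<longleftrightarrow> well_sorted S \<phi> \<and> free_vars \<phi> = {}"

fun quantifier_free :: "('f, 'r, 'v) fm \<Rightarrow> bool" where
  "quantifier_free (Neg \<phi>) \<longleftrightarrow> quantifier_free \<phi>"
| "quantifier_free (And \<phi> \<psi>) \<longleftrightarrow> quantifier_free \<phi> \<and> quantifier_free \<psi>"
| "quantifier_free (Or \<phi> \<psi>) \<longleftrightarrow> quantifier_free \<phi> \<and> quantifier_free \<psi>"
| "quantifier_free (Ex x \<phi>) \<longleftrightarrow> False"
| "quantifier_free (All x \<phi>) \<longleftrightarrow> False"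
| "quantifier_free _ \<longleftrightarrow> True"

fun is_atom :: "('f, 'r, 'v) fm \<Rightarrow> bool" where
  "is_atom (Eq t u) \<longleftrightarrow> True"
| "is_atom (Rel r ts) \<longleftrightarrow> True"
| "is_atom _ \<longleftrightarrow> False"

fun nnf :: "('f, 'r, 'v) fm \<Rightarrow> bool" where
  "nnf (Neg \<phi>) \<longleftrightarrow> is_atom \<phi>"
| "nnf (And \<phi> \<psi>) \<longleftrightarrow> nnf \<phi> \<and> nnf \<psi>"
| "nnf (Or \<phi> \<psi>) \<longleftrightarrow> nnf \<phi> \<and> nnf \<psi>"
| "nnf (Ex x \<phi>) \<longleftrightarrow> nnf \<phi>"
| "nnf (All x \<phi>) \<longleftrightarrow> nnf \<phi>"
| "nnf _ \<longleftrightarrow> True"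

text \<open>The literals occurring in a quantifier-free formula in negation normal form.\<close>

fun literals :: "('f, 'r, 'v) fm \<Rightarrow> ('f, 'r, 'v) fm set" where
  "literals (Eq t u) = {Eq t u}"
| "literals (Rel r ts) = {Rel r ts}"
| "literals (Neg \<phi>) = {Neg \<phi>}"
| "literals (And \<phi> \<psi>) = literals \<phi> \<union> literals \<psi>"
| "literals (Or \<phi> \<psi>) = literals \<phi> \<union> literals \<psi>"
| "literals _ = {}"

text \<open>Conjunctions of literals; the empty conjunction is \<^term>\<open>Top\<close>.\<close>

fun is_conjunction :: "('f, 'r, 'v) fm \<Rightarrow> bool" where
  "is_conjunction Top \<longleftrightarrow> True"
| "is_conjunction (Eq t u) \<longleftrightarrow> True"
| "is_conjunction (Rel r ts) \<longleftrightarrow> True"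
| "is_conjunction (Neg \<phi>) \<longleftrightarrow> is_atom \<phi>"
| "is_conjunction (And \<phi> \<psi>) \<longleftrightarrow> is_conjunction \<phi> \<and> is_conjunction \<psi>"
| "is_conjunction _ \<longleftrightarrow> False"

record ('f, 'r, 's, 'u) fo_structure =
  univ :: "'s \<Rightarrow> 'u set"
  fun_interp :: "'f \<Rightarrow> 'u list \<Rightarrow> 'u"
  rel_interp :: "'r \<Rightarrow> 'u list \<Rightarrow> bool"

definition is_structure ::
  "('f, 'r, 's) signature \<Rightarrow> ('f, 'r, 's, 'u) fo_structure \<Rightarrow> bool" where
  "is_structure S M \<longleftrightarrow>
     (\<forall>s. univ M s \<noteq> {}) \<and>
     (\<forall>f ss s us. fun_arity S f = Some (ss, s) \<longrightarrow> list_all2 (\<lambda>u s'. u \<in> univ M s') us ss \<longrightarrow>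
        fun_interp M f us \<in> univ M s)"

definition valuation :: "('f, 'r, 's, 'u) fo_structure \<Rightarrow> ('s var \<Rightarrow> 'u) \<Rightarrow> bool" where
  "valuation M v \<longleftrightarrow> (\<forall>x. v x \<in> univ M (sort_of x))"

fun eval_trm :: "('f, 'r, 's, 'u) fo_structure \<Rightarrow> ('v \<Rightarrow> 'u) \<Rightarrow> ('f, 'v) trm \<Rightarrow> 'u" where
  "eval_trm M v (Var x) = v x"
| "eval_trm M v (Fun f ts) = fun_interp M f (map (eval_trm M v) ts)"

fun sat :: "('f, 'r, 's, 'u) fo_structure \<Rightarrow> ('s var \<Rightarrow> 'u) \<Rightarrow> ('f, 'r, 's var) fm \<Rightarrow> bool" where
  "sat M v Top \<longleftrightarrow> True"
| "sat M v Bot \<longleftrightarrow> False"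
| "sat M v (Eq t u) \<longleftrightarrow> eval_trm M v t = eval_trm M v u"
| "sat M v (Rel r ts) \<longleftrightarrow> rel_interp M r (map (eval_trm M v) ts)"
| "sat M v (Neg \<phi>) \<longleftrightarrow> \<not> sat M v \<phi>"
| "sat M v (And \<phi> \<psi>) \<longleftrightarrow> sat M v \<phi> \<and> sat M v \<psi>"
| "sat M v (Or \<phi> \<psi>) \<longleftrightarrow> sat M v \<phi> \<or> sat M v \<psi>"
| "sat M v (Ex x \<phi>) \<longleftrightarrow> (\<exists>u\<in>univ M (sort_of x). sat M (v(x := u)) \<phi>)"
| "sat M v (All x \<phi>) \<longleftrightarrow> (\<forall>u\<in>univ M (sort_of x). sat M (v(x := u)) \<phi>)"

text \<open>
  A theory is a deductively closed set of sentences, and it is complete if it contains each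
  sentence or its negation. Deductive closure is not stated separately: a set with the property
  below that has a model consists of exactly the sentences true in that model.
\<close>

definition complete_theory ::
  "('f, 'r, 's) signature \<Rightarrow> ('f, 'r, 's var) fm set \<Rightarrow> bool" where
  "complete_theory S A \<longleftrightarrow>
     (\<forall>\<phi>\<in>A. is_sentence S \<phi>) \<and> (\<forall>\<phi>. is_sentence S \<phi> \<longrightarrow> \<phi> \<in> A \<or> Neg \<phi> \<in> A)"

text \<open>
  The background part of an interpretation: a model of the theory whose universe only contains
  ground terms. It is fixed once and for all, so that interpretations differ only on
  the predicates of the clauses and on the variables. Valuations into such a structure are
  ground substitutions.
\<close>

definition ground_term_model ::
  "('f, 'r, 's) signature \<Rightarrow> ('f, 'r, 's var) fm set \<Rightarrow>
   ('f, 'r, 's, ('f, 's var) trm) fo_structure \<Rightarrow> bool" where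
  "ground_term_model S A M \<longleftrightarrow>
     is_structure S M \<and>
     (\<forall>s. \<forall>t\<in>univ M s. vars_trm t = {} \<and> has_sort S t s) \<and>
     (\<forall>\<phi>\<in>A. \<forall>v. valuation M v \<longrightarrow> sat M v \<phi>)"

definition satisfiable_fm :: "('f, 'r, 's, 'u) fo_structure \<Rightarrow> ('f, 'r, 's var) fm \<Rightarrow> bool" where
  "satisfiable_fm M \<psi> \<longleftrightarrow> (\<exists>v. valuation M v \<and> sat M v \<psi>)"


section \<open>Linear constrained Horn clauses\<close>

text \<open>
  The body \<^term>\<open>None\<close> stands for truth and the head \<^term>\<open>None\<close> for falsity.
\<close>

type_synonym ('p, 'v) patom = "'p \<times> 'v list"

datatype (dead 'p, dead 'f, dead 'r, vars_clause: 'v) clause =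
  Clause (body: "('p, 'v) patom option") (cond: "('f, 'r, 'v) fm") (head: "('p, 'v) patom option")
for map: rename_clause

fun atom_vars :: "('p, 'v) patom option \<Rightarrow> 'v list" where
  "atom_vars None = []"
| "atom_vars (Some (F, xs)) = xs"

definition atom_ok :: "('p \<rightharpoonup> 's list) \<Rightarrow> ('p, 's var) patom option \<Rightarrow> bool" where
  "atom_ok P a \<longleftrightarrow> (\<forall>F xs. a = Some (F, xs) \<longrightarrow> P F = Some (map sort_of xs))"

definition is_chc ::
  "('f, 'r, 's) signature \<Rightarrow> ('p \<rightharpoonup> 's list) \<Rightarrow> ('p, 'f, 'r, 's var) clause \<Rightarrow> bool" where
  "is_chc S P c \<longleftrightarrow>
     atom_ok P (body c) \<and> atom_ok P (head c) \<and>
     distinct (atom_vars (body c) @ atom_vars (head c)) \<and>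
     well_sorted S (cond c) \<and> quantifier_free (cond c) \<and> nnf (cond c)"

definition chc_problem ::
  "('f, 'r, 's) signature \<Rightarrow> ('p \<rightharpoonup> 's list) \<Rightarrow> ('p, 'f, 'r, 's var) clause set \<Rightarrow> bool" where
  "chc_problem S P \<Phi> \<longleftrightarrow> finite \<Phi> \<and> (\<forall>c\<in>\<Phi>. is_chc S P c)"

definition is_fact :: "('p, 'f, 'r, 'v) clause \<Rightarrow> bool" where
  "is_fact c \<longleftrightarrow> body c = None \<and> head c \<noteq> None"

definition is_rule :: "('p, 'f, 'r, 'v) clause \<Rightarrow> bool" where
  "is_rule c \<longleftrightarrow> body c \<noteq> None \<and> head c \<noteq> None"

definition is_query :: "('p, 'f, 'r, 'v) clause \<Rightarrow> bool" where
  "is_query c \<longleftrightarrow> body c \<noteq> None \<and> head c = None"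

definition is_cond_empty :: "('p, 'f, 'r, 'v) clause \<Rightarrow> bool" where
  "is_cond_empty c \<longleftrightarrow> body c = None \<and> head c = None"

definition recursive :: "('p, 'f, 'r, 'v) clause \<Rightarrow> bool" where
  "recursive c \<longleftrightarrow> (\<exists>F xs ys. body c = Some (F, xs) \<and> head c = Some (F, ys))"

definition conjunctive :: "('p, 'f, 'r, 'v) clause \<Rightarrow> bool" where
  "conjunctive c \<longleftrightarrow> is_conjunction (cond c)"

text \<open>
  Satisfaction of the universal closure of a clause. The interpretation \<^term>\<open>I\<close> of the predicates
  is the only part of an interpretation that is not determined by \<^term>\<open>M\<close>.
\<close>

definition clause_true ::
  "('f, 'r, 's, 'u) fo_structure \<Rightarrow> ('p \<Rightarrow> 'u list \<Rightarrow> bool) \<Rightarrow> ('p, 'f, 'r, 's var) clause \<Rightarrow> bool" where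
  "clause_true M I c \<longleftrightarrow>
     (\<forall>v. valuation M v \<longrightarrow>
        (case body c of None \<Rightarrow> True | Some (F, xs) \<Rightarrow> I F (map v xs)) \<and> sat M v (cond c) \<longrightarrow>
        (case head c of None \<Rightarrow> False | Some (G, ys) \<Rightarrow> I G (map v ys)))"

definition satisfiable ::
  "('f, 'r, 's, 'u) fo_structure \<Rightarrow> ('p, 'f, 'r, 's var) clause set \<Rightarrow> bool" where
  "satisfiable M \<Phi> \<longleftrightarrow> (\<exists>I. \<forall>c\<in>\<Phi>. clause_true M I c)"

text \<open>A ground instance is represented by its instantiated body and head.\<close>

type_synonym ('p, 'u) ground_clause = "('p \<times> 'u list) option \<times> ('p \<times> 'u list) option"

definition inst :: "('v \<Rightarrow> 'u) \<Rightarrow> ('p, 'v) patom option \<Rightarrow> ('p \<times> 'u list) option" where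
  "inst v = map_option (map_prod id (map v))"

definition grnd ::
  "('f, 'r, 's, 'u) fo_structure \<Rightarrow> ('p, 'f, 'r, 's var) clause \<Rightarrow> ('p, 'u) ground_clause set" where
  "grnd M c = {(inst v (body c), inst v (head c)) | v. valuation M v \<and> sat M v (cond c)}"


section \<open>Resolution\<close>

text \<open>
  Clauses are represented concretely, and variables are renamed apart inside the definition of
  resolution: those of the first clause to even, those of the second one to odd indices. As the
  arguments of the atoms are pairwise different variables, the most general unifier of the atoms
  resolved upon just replaces the arguments \<^term>\<open>ys\<close> of the second one by the arguments \<^term>\<open>xs\<close>
  of the first one; see the lemma below.
\<close>

definition rename_even :: "'s var \<Rightarrow> 's var" where
  "rename_even = (\<lambda>(n, s). (2 * n, s))"

definition rename_odd :: "'s var \<Rightarrow> 's var" where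
  "rename_odd = (\<lambda>(n, s). (2 * n + 1, s))"

definition mgu_args :: "'v list \<Rightarrow> 'v list \<Rightarrow> 'v \<Rightarrow> 'v" where
  "mgu_args xs ys = (\<lambda>z. case map_of (zip ys xs) z of Some x \<Rightarrow> x | None \<Rightarrow> z)"

fun res_apart ::
  "('p, 'f, 'r, 'v) clause \<Rightarrow> ('p, 'f, 'r, 'v) clause \<Rightarrow> ('p, 'f, 'r, 'v) clause" where
  "res_apart (Clause \<eta> \<psi> (Some (F, xs))) (Clause (Some (G, ys)) \<psi>' \<eta>') =
     (if F = G then rename_clause (mgu_args xs ys) (Clause \<eta> (And \<psi> \<psi>') \<eta>')
      else Clause None Bot None)"
| "res_apart _ _ = Clause None Bot None"

definition res ::
  "('p, 'f, 'r, 's var) clause \<Rightarrow> ('p, 'f, 'r, 's var) clause \<Rightarrow> ('p, 'f, 'r, 's var) clause" where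
  "res c d = res_apart (rename_clause rename_even c) (rename_clause rename_odd d)"

fun subst_trm :: "('v \<Rightarrow> ('f, 'v) trm) \<Rightarrow> ('f, 'v) trm \<Rightarrow> ('f, 'v) trm" where
  "subst_trm \<sigma> (Var x) = \<sigma> x"
| "subst_trm \<sigma> (Fun f ts) = Fun f (map (subst_trm \<sigma>) ts)"

definition is_subst :: "('f, 'r, 's) signature \<Rightarrow> ('s var \<Rightarrow> ('f, 's var) trm) \<Rightarrow> bool" where
  "is_subst S \<sigma> \<longleftrightarrow> (\<forall>x. has_sort S (\<sigma> x) (sort_of x))"

definition unifier :: "('v \<Rightarrow> ('f, 'v) trm) \<Rightarrow> ('p, 'v) patom \<Rightarrow> ('p, 'v) patom \<Rightarrow> bool" where
  "unifier \<sigma> a b \<longleftrightarrow> fst a = fst b \<and> map \<sigma> (snd a) = map \<sigma> (snd b)"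

definition is_mgu ::
  "('f, 'r, 's) signature \<Rightarrow> ('s var \<Rightarrow> ('f, 's var) trm) \<Rightarrow>
   ('p, 's var) patom \<Rightarrow> ('p, 's var) patom \<Rightarrow> bool" where
  "is_mgu S \<theta> a b \<longleftrightarrow>
     is_subst S \<theta> \<and> unifier \<theta> a b \<and>
     (\<forall>\<sigma>. is_subst S \<sigma> \<and> unifier \<sigma> a b \<longrightarrow>
        (\<exists>\<delta>. is_subst S \<delta> \<and> (\<forall>x. \<sigma> x = subst_trm \<delta> (\<theta> x))))"

lemma is_mgu_mgu_args:
  fixes S :: "('f, 'r, 's) signature" and P :: "'p \<rightharpoonup> 's list"
  assumes "atom_ok P (Some (F, xs))" "atom_ok P (Some (F, ys))"
    and "distinct xs" "distinct ys" "set xs \<inter> set ys = {}"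
  shows "is_mgu S (Var \<circ> mgu_args xs ys) (F, xs) (F, ys)"
proof -
  have sorts: "map sort_of xs = map sort_of ys"
    using assms(1,2) by (simp add: atom_ok_def)
  hence len: "length xs = length ys" using map_eq_imp_length_eq by blast
  have ys: "mgu_args xs ys (ys ! i) = xs ! i" if "i < length ys" for i
    using that assms(4) len by (simp add: mgu_args_def map_of_zip_nth)
  have other: "mgu_args xs ys z = z" if "z \<notin> set ys" for z
    using that len
    by (auto simp: mgu_args_def split: option.splits dest!: map_of_SomeD set_zip_leftD)
  have cases: "z \<notin> set ys \<or> (\<exists>i<length ys. z = ys ! i)" for z
    by (metis in_set_conv_nth)
  have sort: "sort_of (mgu_args xs ys z) = sort_of z" for z
    using cases[of z] other[of z] ys sorts len by (metis nth_map)
  have "is_subst S (Var \<circ> mgu_args xs ys)"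
    by (metis comp_apply has_sort.intros(1) is_subst_def sort)
  moreover have "unifier (Var \<circ> mgu_args xs ys) (F, xs) (F, ys)"
  proof -
    have "mgu_args xs ys (xs ! i) = mgu_args xs ys (ys ! i)" if "i < length xs" for i
      using that len ys other[of "xs ! i"] assms(5) by (metis disjoint_iff nth_mem)
    thus ?thesis using len by (auto simp: unifier_def intro: nth_equalityI)
  qed
  moreover have "\<sigma> z = subst_trm \<sigma> ((Var \<circ> mgu_args xs ys) z)"
    if "unifier \<sigma> (F, xs) (F, ys)" for \<sigma> :: "'s var \<Rightarrow> ('f, 's var) trm" and z
    using that cases[of z] other[of z] ys len
    by (auto simp: unifier_def) (metis nth_map)
  ultimately show ?thesis unfolding is_mgu_def by blast
qed

text \<open>The resolvent of the empty sequence is left unspecified.\<close>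

fun res_seq :: "('p, 'f, 'r, 's var) clause list \<Rightarrow> ('p, 'f, 'r, 's var) clause" where
  "res_seq [c] = c"
| "res_seq (c # d # cs) = res_seq (res c d # cs)"

definition refutation ::
  "('f, 'r, 's, 'u) fo_structure \<Rightarrow> ('p, 'f, 'r, 's var) clause list \<Rightarrow> bool" where
  "refutation M cs \<longleftrightarrow>
     cs \<noteq> [] \<and> is_cond_empty (res_seq cs) \<and> satisfiable_fm M (cond (res_seq cs))"


section \<open>Acceleration, syntactic implicants, redundancy\<close>

definition acceleration_technique ::
  "('f, 'r, 's) signature \<Rightarrow> ('p \<rightharpoonup> 's list) \<Rightarrow> ('f, 'r, 's, 'u) fo_structure \<Rightarrow>
   (('p, 'f, 'r, 's var) clause \<Rightarrow> ('p, 'f, 'r, 's var) clause) \<Rightarrow> bool" where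
  "acceleration_technique S P M accel \<longleftrightarrow>
     (\<forall>c. is_chc S P c \<and> recursive c \<and> conjunctive c \<longrightarrow>
        is_chc S P (accel c) \<and> recursive (accel c) \<and> conjunctive (accel c) \<and>
        grnd M (accel c) = (\<Union>n\<in>{1..}. grnd M (res_seq (replicate n c))))"

text \<open>
  Conjunctions are identified with sets of literals. Hence the syntactic implicant of \<^term>\<open>\<psi>\<close>
  under \<^term>\<open>v\<close> is represented by the set of all conjunctions with the required set of literals.
\<close>

definition sip_under ::
  "('f, 'r, 's, 'u) fo_structure \<Rightarrow> ('f, 'r, 's var) fm \<Rightarrow> ('s var \<Rightarrow> 'u) \<Rightarrow>
   ('f, 'r, 's var) fm set" where
  "sip_under M \<psi> v = {\<chi>. is_conjunction \<chi> \<and> literals \<chi> = {l \<in> literals \<psi>. sat M v l}}"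

definition sip_fm ::
  "('f, 'r, 's, 'u) fo_structure \<Rightarrow> ('f, 'r, 's var) fm \<Rightarrow> ('f, 'r, 's var) fm set" where
  "sip_fm M \<psi> = (\<Union>v\<in>{v. valuation M v \<and> sat M v \<psi>}. sip_under M \<psi> v)"

definition sip_clause ::
  "('f, 'r, 's, 'u) fo_structure \<Rightarrow> ('p, 'f, 'r, 's var) clause \<Rightarrow>
   ('p, 'f, 'r, 's var) clause set" where
  "sip_clause M c = {Clause (body c) \<chi> (head c) | \<chi>. \<chi> \<in> sip_fm M (cond c)}"

definition sip ::
  "('f, 'r, 's, 'u) fo_structure \<Rightarrow> ('p, 'f, 'r, 's var) clause set \<Rightarrow>
   ('p, 'f, 'r, 's var) clause set" where
  "sip M \<Pi> = (\<Union>c\<in>\<Pi>. sip_clause M c)"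

definition redundant ::
  "('f, 'r, 's, 'u) fo_structure \<Rightarrow> ('p, 'f, 'r, 's var) clause \<Rightarrow>
   ('p, 'f, 'r, 's var) clause set \<Rightarrow> bool" where
  "redundant M c \<Pi> \<longleftrightarrow> (\<exists>d\<in>\<Pi>. grnd M c \<subseteq> grnd M d)"

definition strictly_redundant ::
  "('f, 'r, 's, 'u) fo_structure \<Rightarrow> ('p, 'f, 'r, 's var) clause \<Rightarrow>
   ('p, 'f, 'r, 's var) clause set \<Rightarrow> bool" where
  "strictly_redundant M c \<Pi> \<longleftrightarrow> (\<exists>d\<in>\<Pi>. grnd M c \<subset> grnd M d)"


section \<open>The ADCL calculus\<close>

datatype ('p, 'f, 'r, 'v) state =
    Input "('p, 'f, 'r, 'v) clause set"
  | State "('p, 'f, 'r, 'v) clause set" "('p, 'f, 'r, 'v) clause list"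
      "('p, 'f, 'r, 'v) clause set list"
  | Unsat
  | Sat

fun is_state ::
  "('f, 'r, 's) signature \<Rightarrow> ('p \<rightharpoonup> 's list) \<Rightarrow> ('f, 'r, 's, 'u) fo_structure \<Rightarrow>
   ('p, 'f, 'r, 's var) clause set \<Rightarrow> ('p, 'f, 'r, 's var) state \<Rightarrow> bool" where
  "is_state S P M \<Phi> (Input \<Psi>) \<longleftrightarrow> \<Psi> = \<Phi>"
| "is_state S P M \<Phi> (State \<Pi> cs Bs) \<longleftrightarrow>
     chc_problem S P \<Pi> \<and> \<Phi> \<subseteq> \<Pi> \<and> set cs \<subseteq> sip M \<Pi> \<and>
     length Bs = length cs + 1 \<and> (\<forall>B\<in>set Bs. B \<subseteq> sip M \<Pi>)"
| "is_state S P M \<Phi> Unsat \<longleftrightarrow> True"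
| "is_state S P M \<Phi> Sat \<longleftrightarrow> True"

definition active ::
  "('f, 'r, 's, 'u) fo_structure \<Rightarrow> ('p, 'f, 'r, 's var) clause list \<Rightarrow>
   ('p, 'f, 'r, 's var) clause set list \<Rightarrow> ('p, 'f, 'r, 's var) clause \<Rightarrow> bool" where
  "active M cs Bs c \<longleftrightarrow>
     \<not> redundant M c (last Bs) \<and> satisfiable_fm M (cond (res_seq (cs @ [c])))"

definition bt ::
  "('p, 'f, 'r, 'v) clause set \<Rightarrow> ('p, 'f, 'r, 'v) clause list \<Rightarrow>
   ('p, 'f, 'r, 'v) clause set list \<Rightarrow> ('p, 'f, 'r, 'v) state" where
  "bt \<Pi> cs Bs =
     State \<Pi> (butlast cs) (butlast (butlast Bs) @ [last (butlast Bs) \<union> {last cs}])"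

definition covered ::
  "('f, 'r, 's, 'u) fo_structure \<Rightarrow> ('p, 'f, 'r, 's var) clause set \<Rightarrow>
   ('p, 'f, 'r, 's var) clause list \<Rightarrow> bool" where
  "covered M \<Pi> cs \<longleftrightarrow> cs \<noteq> [] \<and>
     (strictly_redundant M (res_seq cs) (sip M \<Pi>) \<or>
      redundant M (res_seq cs) (sip M \<Pi>) \<and> length cs > 1)"

text \<open>
  Transitions are labelled with the rule that is applied and with those parameters of the
  application that are needed to formulate strategies.
\<close>

datatype ('p, 'f, 'r, 'v) adcl_rule =
    Init
  | Step "('p, 'f, 'r, 'v) clause"
  | Accelerate "('p, 'f, 'r, 'v) clause list"
  | Covered
  | Backtrack
  | Refute
  | Prove

inductive apply_rule ::
  "('f, 'r, 's, 'u) fo_structure \<Rightarrow>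
   (('p, 'f, 'r, 's var) clause \<Rightarrow> ('p, 'f, 'r, 's var) clause) \<Rightarrow>
   ('p, 'f, 'r, 's var) adcl_rule \<Rightarrow>
   ('p, 'f, 'r, 's var) state \<Rightarrow> ('p, 'f, 'r, 's var) state \<Rightarrow> bool"
  for M accel where
  init: "apply_rule M accel Init (Input \<Phi>) (State \<Phi> [] [{}])"
| step: "c \<in> sip M \<Pi> \<Longrightarrow> active M cs Bs c \<Longrightarrow>
    apply_rule M accel (Step c) (State \<Pi> cs Bs) (State \<Pi> (cs @ [c]) (Bs @ [{}]))"
| accelerate: "ds \<noteq> [] \<Longrightarrow> recursive (res_seq ds) \<Longrightarrow> length ds = length Ds \<Longrightarrow>
    accel (res_seq ds) = c \<Longrightarrow>
    apply_rule M accel (Accelerate ds)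
      (State \<Pi> (cs @ ds) (Bs @ Ds)) (State (\<Pi> \<union> {c}) (cs @ [c]) (Bs @ [{c}]))"
| covered: "covered M \<Pi> ds \<Longrightarrow>
    apply_rule M accel Covered (State \<Pi> (cs @ ds) Bs) (bt \<Pi> (cs @ ds) Bs)"
| backtrack: "\<forall>d\<in>sip M \<Pi>. is_rule d \<or> is_query d \<longrightarrow> \<not> active M (cs @ [c]) Bs d \<Longrightarrow>
    \<not> is_query c \<Longrightarrow>
    apply_rule M accel Backtrack (State \<Pi> (cs @ [c]) Bs) (bt \<Pi> (cs @ [c]) Bs)"
| refuted: "refutation M cs \<Longrightarrow> apply_rule M accel Refute (State \<Pi> cs Bs) Unsat"
| proved: "\<forall>d\<in>sip M \<Pi>. is_fact d \<or> is_cond_empty d \<longrightarrow> \<not> active M [] [B] d \<Longrightarrow>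
    apply_rule M accel Prove (State \<Pi> [] [B]) Sat"

definition adcl ::
  "('f, 'r, 's) signature \<Rightarrow> ('p \<rightharpoonup> 's list) \<Rightarrow> ('f, 'r, 's, 'u) fo_structure \<Rightarrow>
   (('p, 'f, 'r, 's var) clause \<Rightarrow> ('p, 'f, 'r, 's var) clause) \<Rightarrow>
   ('p, 'f, 'r, 's var) clause set \<Rightarrow> ('p, 'f, 'r, 's var) adcl_rule \<Rightarrow>
   ('p, 'f, 'r, 's var) state \<Rightarrow> ('p, 'f, 'r, 's var) state \<Rightarrow> bool" where
  "adcl S P M accel \<Phi> r s s' \<longleftrightarrow>
     is_state S P M \<Phi> s \<and> is_state S P M \<Phi> s' \<and> apply_rule M accel r s s'"


section \<open>Reasonable strategies\<close>

text \<open>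
  The first restriction depends on the derivation so far, which is represented by the non-empty
  list \<^term>\<open>h\<close> of its states, the current one being the last.
\<close>

definition must_cover ::
  "('f, 'r, 's, 'u) fo_structure \<Rightarrow> ('p, 'f, 'r, 's var) state list \<Rightarrow> bool" where
  "must_cover M h \<longleftrightarrow>
     (\<exists>\<Pi> cs Bs ds Bs'. State \<Pi> cs Bs \<in> set (butlast h) \<and>
        last h = State \<Pi> (cs @ ds) Bs' \<and> covered M \<Pi> ds)"

definition acceleration_candidate ::
  "('f, 'r, 's, 'u) fo_structure \<Rightarrow>
   (('p, 'f, 'r, 's var) clause \<Rightarrow> ('p, 'f, 'r, 's var) clause) \<Rightarrow>
   ('p, 'f, 'r, 's var) clause set \<Rightarrow> ('p, 'f, 'r, 's var) clause list \<Rightarrow>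
   ('p, 'f, 'r, 's var) clause list \<Rightarrow> bool" where
  "acceleration_candidate M accel \<Pi> cs ds \<longleftrightarrow>
     ds \<noteq> [] \<and> (\<exists>bs. cs = bs @ ds) \<and> recursive (res_seq ds) \<and>
     \<not> redundant M (accel (res_seq ds)) (sip M \<Pi>)"

text \<open>
  Preferring Accelerate over Step refers to those applications of Accelerate
  that the strategy permits, i.e., to non-redundant ones.
\<close>

definition reasonable ::
  "('f, 'r, 's, 'u) fo_structure \<Rightarrow>
   (('p, 'f, 'r, 's var) clause \<Rightarrow> ('p, 'f, 'r, 's var) clause) \<Rightarrow>
   ('p, 'f, 'r, 's var) state list \<Rightarrow> ('p, 'f, 'r, 's var) adcl_rule \<Rightarrow> bool" where
  "reasonable M accel h r \<longleftrightarrow>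
     (must_cover M h \<longrightarrow> r = Covered) \<and>
     (\<forall>\<Pi> cs Bs. last h = State \<Pi> cs Bs \<longrightarrow>
        (\<forall>c. r = Step c \<longrightarrow>
           (\<nexists>ds. acceleration_candidate M accel \<Pi> cs ds) \<and>
           (cs = [] \<longrightarrow> is_fact c \<or> is_cond_empty c)) \<and>
        (\<forall>ds. r = Accelerate ds \<longrightarrow>
           acceleration_candidate M accel \<Pi> cs ds \<and>
           (\<forall>ds'. acceleration_candidate M accel \<Pi> cs ds' \<longrightarrow> length ds \<le> length ds')))"

inductive rs_derivation ::
  "('f, 'r, 's) signature \<Rightarrow> ('p \<rightharpoonup> 's list) \<Rightarrow> ('f, 'r, 's, 'u) fo_structure \<Rightarrow>
   (('p, 'f, 'r, 's var) clause \<Rightarrow> ('p, 'f, 'r, 's var) clause) \<Rightarrow>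
   ('p, 'f, 'r, 's var) clause set \<Rightarrow> ('p, 'f, 'r, 's var) state list \<Rightarrow> bool"
  for S P M accel \<Phi> where
  start: "rs_derivation S P M accel \<Phi> [Input \<Phi>]"
| extend: "rs_derivation S P M accel \<Phi> h \<Longrightarrow> adcl S P M accel \<Phi> r (last h) s \<Longrightarrow>
    reasonable M accel h r \<Longrightarrow> rs_derivation S P M accel \<Phi> (h @ [s])"

definition rs_reaches ::
  "('f, 'r, 's) signature \<Rightarrow> ('p \<rightharpoonup> 's list) \<Rightarrow> ('f, 'r, 's, 'u) fo_structure \<Rightarrow>
   (('p, 'f, 'r, 's var) clause \<Rightarrow> ('p, 'f, 'r, 's var) clause) \<Rightarrow>
   ('p, 'f, 'r, 's var) clause set \<Rightarrow> ('p, 'f, 'r, 's var) state \<Rightarrow> bool" where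
  "rs_reaches S P M accel \<Phi> s \<longleftrightarrow> (\<exists>h. rs_derivation S P M accel \<Phi> h \<and> last h = s)"

end

theory Submission
  imports Defs
begin

text \<open>
  On ground instances, resolution is relational composition and acceleration is transitive closure.
  After each acceleration, one fixes a completion of the trace to a refutation by syntactic
  implicants that is as short as possible and whose clauses have maximal sets of ground instances.
  No part of such a completion is ever covered, since replacing it by the covering clause would
  shorten the completion or enlarge a clause. As the clause set grows with each acceleration, only
  states since the last acceleration matter for the first restriction of a reasonable strategy.
  A clause that is blocked by the clause learned last could be dropped from the completion, since
  the learned clause is transitive. When an acceleration is due, the learned clause replaces the
  accelerated suffix of the trace, and a new completion of at most the same length is fixed.
\<close>

section \<open>Renaming\<close>

lemma eval_rename_trm: "eval_trm M v (rename_trm f t) = eval_trm M (v \<circ> f) t"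
proof (induction t)
  case (Fun g ts)
  thus ?case by (simp cong: map_cong)
qed simp

text \<open>\<open>rename_fm\<close> also renames bound variables, so a renaming that is not
  injective could cause capture; on quantifier-free formulas it is an ordinary substitution of
  variables.\<close>

lemma sat_rename_fm:
  "quantifier_free \<phi> \<Longrightarrow> sat M v (rename_fm f \<phi>) \<longleftrightarrow> sat M (v \<circ> f) \<phi>"
  by (induction \<phi>) (simp_all add: eval_rename_trm comp_def)

lemma quantifier_free_rename_fm [simp]: "quantifier_free (rename_fm f \<phi>) \<longleftrightarrow> quantifier_free \<phi>"
  by (induction \<phi>) simp_all

lemma is_atom_rename_fm [simp]: "is_atom (rename_fm f \<phi>) \<longleftrightarrow> is_atom \<phi>"
  by (cases \<phi>) simp_all

lemma nnf_rename_fm [simp]: "nnf (rename_fm f \<phi>) \<longleftrightarrow> nnf \<phi>"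
  by (induction \<phi>) simp_all

lemma is_conjunction_rename_fm [simp]: "is_conjunction (rename_fm f \<phi>) \<longleftrightarrow> is_conjunction \<phi>"
  by (induction \<phi>) simp_all

lemma has_sort_rename_trm:
  assumes "has_sort S t s" "\<And>x. sort_of (f x) = sort_of x"
  shows "has_sort S (rename_trm f t) s"
  using assms(1)
proof (induction rule: has_sort.induct)
  case (1 x)
  show ?case using has_sort.intros(1)[of S "f x"] assms(2) by simp
next
  case (2 g ss s ts)
  from 2(2) have "list_all2 (has_sort S) (map (rename_trm f) ts) ss"
    by (simp add: list_all2_map1 list_all2_mono)
  with 2(1) show ?case by (simp add: has_sort.intros(2))
qed

lemma well_sorted_rename_fm:
  assumes "\<And>x. sort_of (f x) = sort_of x"
  shows "well_sorted S \<phi> \<Longrightarrow> well_sorted S (rename_fm f \<phi>)"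
proof (induction \<phi>)
  case (Eq t u)
  thus ?case using has_sort_rename_trm[OF _ assms] by auto
next
  case (Rel r ts)
  then obtain ss where "rel_arity S r = Some ss" "list_all2 (has_sort S) ts ss" by auto
  moreover from this(2) have "list_all2 (has_sort S) (map (rename_trm f) ts) ss"
    unfolding list_all2_map1 by (rule list_all2_mono) (rule has_sort_rename_trm[OF _ assms])
  ultimately show ?case by simp
qed auto

lemma atom_vars_map [simp]:
  "atom_vars (map_option (map_prod id (map f)) a) = map f (atom_vars a)"
  by (cases a) auto

lemma inst_map: "inst v (map_option (map_prod id (map f)) a) = inst (v \<circ> f) a"
  by (cases a) (auto simp: inst_def)

lemma inst_None [simp]: "inst v None = None"
  by (simp add: inst_def)

lemma inst_eq_None [simp]: "inst v a = None \<longleftrightarrow> a = None"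
  by (simp add: inst_def)

lemma None_eq_inst [simp]: "None = inst v a \<longleftrightarrow> a = None"
  by (auto simp: inst_def)

lemma atom_ok_map:
  assumes "atom_ok P a" "\<And>x. sort_of (f x) = sort_of x"
  shows "atom_ok P (map_option (map_prod id (map f)) a)"
  using assms by (auto simp: atom_ok_def comp_def)

lemma valuation_rename:
  "valuation M v \<Longrightarrow> (\<And>x. sort_of (f x) = sort_of x) \<Longrightarrow> valuation M (v \<circ> f)"
  by (metis comp_apply valuation_def)

lemma sort_rename_even [simp]: "sort_of (rename_even x) = sort_of x"
  by (simp add: rename_even_def split: prod.splits)

lemma sort_rename_odd [simp]: "sort_of (rename_odd x) = sort_of x"
  by (simp add: rename_odd_def split: prod.splits)

lemma inj_rename_even: "inj_on rename_even X"
  by (auto simp: rename_even_def inj_on_def)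

lemma inj_rename_odd: "inj_on rename_odd X"
  by (auto simp: rename_odd_def inj_on_def)

lemma rename_even_neq_odd [simp]: "rename_even x \<noteq> rename_odd y"
  unfolding rename_even_def rename_odd_def by (cases x; cases y) (simp, presburger)

lemmas rename_odd_neq_even [simp] = rename_even_neq_odd[symmetric]

section \<open>Most general unifiers of argument lists\<close>

lemma mgu_args_other:
  assumes "z \<notin> set ys"
  shows "mgu_args xs ys z = z"
  using assms
  by (auto simp: mgu_args_def split: option.splits dest!: map_of_SomeD set_zip_leftD)

lemma mgu_args_nth:
  assumes "length xs = length ys" "distinct ys" "i < length ys"
  shows "mgu_args xs ys (ys ! i) = xs ! i"
  using assms by (simp add: mgu_args_def map_of_zip_nth)

lemma sort_mgu_args:
  assumes "map sort_of xs = map sort_of ys" "distinct ys"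
  shows "sort_of (mgu_args xs ys z) = sort_of z"
proof (cases "z \<in> set ys")
  case True
  then obtain i where i: "i < length ys" "z = ys ! i" by (metis in_set_conv_nth)
  have "length xs = length ys" using assms(1) map_eq_imp_length_eq by blast
  with i assms show ?thesis by (metis mgu_args_nth nth_map)
qed (simp add: mgu_args_other)

lemma map_mgu_args:
  assumes "length xs = length ys" "distinct ys"
  shows "map (mgu_args xs ys) ys = xs"
  using assms by (intro nth_equalityI) (simp_all add: mgu_args_nth)

lemma map_mgu_args_other:
  assumes "set zs \<inter> set ys = {}"
  shows "map (mgu_args xs ys) zs = zs"
  using assms by (intro map_idI mgu_args_other) auto


section \<open>Ground instances of resolvents\<close>

text \<open>A set of ground clauses is read as a relation from bodies to heads, and this is
  relational composition. The middle must be a \<open>Some\<close>: a head \<open>None\<close> is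
  falsity while a body \<open>None\<close> is truth, so these two must not be joined.\<close>

definition glue ::
  "('p, 'u) ground_clause set \<Rightarrow> ('p, 'u) ground_clause set \<Rightarrow> ('p, 'u) ground_clause set" where
  "glue R Q = {(b, h) | b m h. (b, Some m) \<in> R \<and> (Some m, h) \<in> Q}"

lemma glue_assoc: "glue (glue R Q) T = glue R (glue Q T)"
  unfolding glue_def by blast

lemma glue_mono: "R \<subseteq> R' \<Longrightarrow> Q \<subseteq> Q' \<Longrightarrow> glue R Q \<subseteq> glue R' Q'"
  unfolding glue_def by blast

lemma satisfiable_fm_iff_grnd: "satisfiable_fm M (cond c) \<longleftrightarrow> grnd M c \<noteq> {}"
  unfolding satisfiable_fm_def grnd_def by blast

abbreviation no_res :: "('p, 'f, 'r, 'v) clause" where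
  "no_res \<equiv> Clause None Bot None"

lemma grnd_no_res [simp]: "grnd M no_res = {}"
  by (simp add: grnd_def)

lemma is_chc_no_res [simp]: "is_chc S P no_res"
  by (simp add: is_chc_def atom_ok_def)

text \<open>All later facts about a single resolvent start from this case distinction, so that the
  pattern matching of \<open>res_apart\<close> is unfolded only here.\<close>

lemma res_cases:
  assumes c: "is_chc S P c" and d: "is_chc S P d"
  obtains
    (mismatch) "res c d = no_res"
      "\<nexists>F xs ys. head c = Some (F, xs) \<and> body d = Some (F, ys)"
  | (match) F xs ys \<theta> where "head c = Some (F, xs)" "body d = Some (F, ys)"
      "\<theta> = mgu_args (map rename_even xs) (map rename_odd ys)"
      "map sort_of xs = map sort_of ys" "distinct ys"
      "\<And>z. sort_of (\<theta> z) = sort_of z"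
      "body (res c d) = map_option (map_prod id (map (\<theta> \<circ> rename_even))) (body c)"
      "head (res c d) = map_option (map_prod id (map (\<theta> \<circ> rename_odd))) (head d)"
      "cond (res c d) =
         And (rename_fm \<theta> (rename_fm rename_even (cond c)))
           (rename_fm \<theta> (rename_fm rename_odd (cond d)))"
proof (cases "\<exists>F xs ys. head c = Some (F, xs) \<and> body d = Some (F, ys)")
  case True
  then obtain F xs ys where h: "head c = Some (F, xs)" and b: "body d = Some (F, ys)" by blast
  define \<theta> where "\<theta> = mgu_args (map rename_even xs) (map rename_odd ys)"
  have sorts: "map sort_of xs = map sort_of ys"
    using c d h b by (simp add: is_chc_def atom_ok_def)
  have ys: "distinct ys" using d b by (simp add: is_chc_def)
  have "map sort_of (map rename_even xs) = map sort_of (map rename_odd ys)"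
    using sorts by (simp add: comp_def)
  moreover have "distinct (map rename_odd ys)"
    using ys by (simp add: distinct_map inj_rename_odd)
  ultimately have sort: "sort_of (\<theta> z) = sort_of z" for z
    unfolding \<theta>_def by (rule sort_mgu_args)
  obtain B \<psi> where c': "c = Clause B \<psi> (Some (F, xs))" using h by (cases c) auto
  obtain H \<psi>' where d': "d = Clause (Some (F, ys)) \<psi>' H" using b by (cases d) auto
  have "res c d = rename_clause \<theta>
      (Clause (map_option (map_prod id (map rename_even)) B)
        (And (rename_fm rename_even \<psi>) (rename_fm rename_odd \<psi>'))
        (map_option (map_prod id (map rename_odd)) H))"
    by (simp add: res_def c' d' \<theta>_def)
  hence "body (res c d) = map_option (map_prod id (map (\<theta> \<circ> rename_even))) (body c)"
    "head (res c d) = map_option (map_prod id (map (\<theta> \<circ> rename_odd))) (head d)"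
    "cond (res c d) =
         And (rename_fm \<theta> (rename_fm rename_even (cond c)))
           (rename_fm \<theta> (rename_fm rename_odd (cond d)))"
    by (simp_all add: c' d' option.map_comp comp_def prod.map_comp id_def)
  thus thesis using match[OF h b \<theta>_def sorts ys sort] by blast
next
  case False
  moreover obtain B \<psi> H B' \<psi>' H' where "c = Clause B \<psi> H" "d = Clause B' \<psi>' H'"
    by (metis clause.collapse)
  ultimately have "res c d = no_res"
    by (cases H; cases B') (auto simp: res_def)
  thus thesis using mismatch False by blast
qed

lemma is_chc_res:
  assumes c: "is_chc S P c" and d: "is_chc S P d"
  shows "is_chc S P (res c d)"
  using c d
proof (cases rule: res_cases)
  case (match F xs ys \<theta>)
  \<comment> \<open>The unifier moves only the odd copies of \<open>ys\<close>. Body variables of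
    \<open>c\<close> become even, and head variables of \<open>d\<close> differ from
    \<open>ys\<close>, so the arguments kept in the resolvent are untouched and stay
    distinct.\<close>
  have "map (\<theta> \<circ> rename_even) (atom_vars (body c)) = map rename_even (atom_vars (body c))"
    unfolding match(3) map_map[symmetric] by (rule map_mgu_args_other) auto
  moreover have "map (\<theta> \<circ> rename_odd) (atom_vars (head d)) = map rename_odd (atom_vars (head d))"
  proof -
    have "set ys \<inter> set (atom_vars (head d)) = {}"
      using d match(2) by (auto simp: is_chc_def)
    thus ?thesis unfolding match(3) map_map[symmetric]
      by (intro map_mgu_args_other) (auto simp flip: image_Int[OF inj_rename_odd])
  qed
  moreover have "distinct (map rename_even (atom_vars (body c)) @ map rename_odd (atom_vars (head d)))"
    using c d by (auto simp: is_chc_def distinct_map inj_rename_even inj_rename_odd)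
  ultimately have "distinct (atom_vars (body (res c d)) @ atom_vars (head (res c d)))"
    by (simp only: match(7,8) atom_vars_map)
  moreover have sort: "sort_of ((\<theta> \<circ> rename_even) z) = sort_of z"
    "sort_of ((\<theta> \<circ> rename_odd) z) = sort_of z" for z
    by (simp_all only: comp_apply match(6) sort_rename_even sort_rename_odd)
  moreover have "atom_ok P (body (res c d))" "atom_ok P (head (res c d))"
    unfolding match(7,8) using c d atom_ok_map[of P _ "\<theta> \<circ> rename_even"]
      atom_ok_map[of P _ "\<theta> \<circ> rename_odd"] sort
    by (simp_all add: is_chc_def)
  moreover have "well_sorted S (cond (res c d))"
    using c d by (simp add: match(6,9) is_chc_def well_sorted_rename_fm)
  ultimately show ?thesis
    using c d match(9) by (simp add: is_chc_def)
qed simp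

lemma grnd_res:
  assumes c: "is_chc S P c" and d: "is_chc S P d"
  shows "grnd M (res c d) = glue (grnd M c) (grnd M d)"
  using c d
proof (cases rule: res_cases)
  case mismatch
  have "glue (grnd M c) (grnd M d) = {}"
    using mismatch(2) by (fastforce simp: glue_def grnd_def inst_def map_option_case split: option.splits)
  thus ?thesis using mismatch(1) by simp
next
  case (match F xs ys \<theta>)
  have qf: "quantifier_free (cond c)" "quantifier_free (cond d)"
    using c d by (simp_all add: is_chc_def)
  have len: "length xs = length ys" using match(4) map_eq_imp_length_eq by blast
  have dist: "distinct (map rename_odd ys)"
    using match(5) by (simp add: distinct_map inj_rename_odd)
  have \<theta>x: "map (\<theta> \<circ> rename_even) xs = map rename_even xs"
    unfolding match(3) map_map[symmetric] by (rule map_mgu_args_other) auto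
  have \<theta>y: "map (\<theta> \<circ> rename_odd) ys = map rename_even xs"
    unfolding match(3) map_map[symmetric] using len dist by (intro map_mgu_args) simp_all
  have grnd: "g \<in> grnd M (res c d) \<longleftrightarrow>
    (\<exists>v. valuation M v \<and> sat M (v \<circ> \<theta> \<circ> rename_even) (cond c) \<and>
      sat M (v \<circ> \<theta> \<circ> rename_odd) (cond d) \<and>
      g = (inst (v \<circ> \<theta> \<circ> rename_even) (body c), inst (v \<circ> \<theta> \<circ> rename_odd) (head d)))" for g
    unfolding grnd_def match(7-9)
    using qf by (auto simp: sat_rename_fm inst_map comp_assoc)
  show ?thesis
  proof (intro subset_antisym subsetI)
    fix g assume "g \<in> grnd M (res c d)"
    then obtain v where v: "valuation M v" "sat M (v \<circ> \<theta> \<circ> rename_even) (cond c)"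
      "sat M (v \<circ> \<theta> \<circ> rename_odd) (cond d)"
      "g = (inst (v \<circ> \<theta> \<circ> rename_even) (body c), inst (v \<circ> \<theta> \<circ> rename_odd) (head d))"
      using grnd by blast
    have "map (v \<circ> \<theta> \<circ> rename_even) xs = map (v \<circ> \<theta> \<circ> rename_odd) ys"
      by (metis \<theta>x \<theta>y comp_assoc map_map)
    hence "inst (v \<circ> \<theta> \<circ> rename_odd) (body d) = inst (v \<circ> \<theta> \<circ> rename_even) (head c)"
      "inst (v \<circ> \<theta> \<circ> rename_even) (head c) = Some (F, map (v \<circ> \<theta> \<circ> rename_even) xs)"
      using match(1,2) by (simp_all add: inst_def)
    moreover have "valuation M (v \<circ> \<theta> \<circ> rename_even)" "valuation M (v \<circ> \<theta> \<circ> rename_odd)"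
      using v(1) match(6) by (auto intro!: valuation_rename)
    ultimately show "g \<in> glue (grnd M c) (grnd M d)"
      unfolding glue_def grnd_def v(4) using v(2,3) by force
  next
    fix g assume "g \<in> glue (grnd M c) (grnd M d)"
    then obtain m where m: "(fst g, Some m) \<in> grnd M c" "(Some m, snd g) \<in> grnd M d"
      by (auto simp: glue_def)
    from m(1) obtain v1 where v1: "valuation M v1" "sat M v1 (cond c)"
      "(fst g, Some m) = (inst v1 (body c), inst v1 (head c))"
      unfolding grnd_def by blast
    from m(2) obtain v2 where v2: "valuation M v2" "sat M v2 (cond d)"
      "(Some m, snd g) = (inst v2 (body d), inst v2 (head d))"
      unfolding grnd_def by blast
    have v: "valuation M v1" "sat M v1 (cond c)" "inst v1 (head c) = Some m"
      "valuation M v2" "sat M v2 (cond d)" "inst v2 (body d) = Some m"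
      "g = (inst v1 (body c), inst v2 (head d))"
      using v1 v2 by (simp_all add: prod_eq_iff)
    \<comment> \<open>The two valuations are merged: \<open>v1\<close> is stored at the even indices
      and \<open>v2\<close> at the odd ones.\<close>
    define v where "v = (\<lambda>(n, s). if even n then v1 (n div 2, s) else v2 (n div 2, s))"
    have even: "v \<circ> rename_even = v1" and odd: "v \<circ> rename_odd = v2"
      by (auto simp: v_def rename_even_def rename_odd_def fun_eq_iff)
    have val: "valuation M v"
      using v(1,4) by (auto simp: valuation_def v_def)
    have xy: "map v1 xs = map v2 ys"
      using v(3,6) match(1,2) by (auto simp: inst_def)
    \<comment> \<open>Both premises instantiate the resolved atom to the same \<open>m\<close>, so
      \<open>v\<close> already gives unified variables equal values.\<close>
    have "v (\<theta> z) = v z" for z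
    proof (cases "z \<in> set (map rename_odd ys)")
      case True
      then obtain i where i: "i < length ys" "z = rename_odd (ys ! i)"
        by (auto simp: in_set_conv_nth)
      have "\<theta> z = rename_even (xs ! i)"
        using i \<theta>y len by (metis comp_apply nth_map)
      moreover have "v1 (xs ! i) = v2 (ys ! i)" using i len xy by (metis nth_map)
      ultimately show ?thesis using i even odd by (metis comp_apply)
    next
      case False
      thus ?thesis unfolding match(3) by (metis mgu_args_other)
    qed
    hence "v \<circ> \<theta> = v" by auto
    thus "g \<in> grnd M (res c d)"
      unfolding grnd using v val even odd by auto
  qed
qed

section \<open>Resolution of sequences of clauses\<close>

lemma conjunctive_res:
  assumes "is_chc S P c" "is_chc S P d" "conjunctive c \<or> c = no_res" "conjunctive d"
  shows "conjunctive (res c d) \<or> res c d = no_res"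
  using assms(1,2)
proof (cases rule: res_cases)
  case match
  with assms(3,4) show ?thesis by (auto simp: conjunctive_def)
qed simp

lemma res_seq_Cons_chc_grnd:
  assumes "\<forall>c\<in>set (c # cs). is_chc S P c"
  shows "is_chc S P (res_seq (c # cs)) \<and>
    grnd M (res_seq (c # cs)) = foldl glue (grnd M c) (map (grnd M) cs)"
  using assms
proof (induction cs arbitrary: c)
  case (Cons d cs)
  have "is_chc S P (res c d)" using Cons.prems by (auto intro: is_chc_res)
  moreover have "grnd M (res c d) = glue (grnd M c) (grnd M d)"
    using Cons.prems by (auto intro!: grnd_res)
  ultimately show ?case using Cons.IH[of "res c d"] Cons.prems by auto
qed auto

lemma is_chc_res_seq:
  assumes "cs \<noteq> []" "\<forall>c\<in>set cs. is_chc S P c"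
  shows "is_chc S P (res_seq cs)"
  using assms by (cases cs) (auto simp: res_seq_Cons_chc_grnd)

text \<open>The default resolvent has condition \<open>Bot\<close>, which is not a conjunction; it
  has to be excluded.\<close>

lemma conjunctive_res_seq:
  assumes "cs \<noteq> []" "\<forall>c\<in>set cs. is_chc S P c \<and> conjunctive c" "res_seq cs \<noteq> no_res"
  shows "conjunctive (res_seq cs)"
proof -
  \<comment> \<open>The accumulated resolvent may become the default clause on the way, so the
    induction admits it as first element.\<close>
  have "conjunctive (res_seq (c # cs)) \<or> res_seq (c # cs) = no_res"
    if "is_chc S P c" "conjunctive c \<or> c = no_res" "\<forall>d\<in>set cs. is_chc S P d \<and> conjunctive d" for c cs
    using that
  proof (induction cs arbitrary: c)
    case (Cons d cs)
    have "is_chc S P (res c d)" using Cons.prems by (auto intro: is_chc_res)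
    moreover have "conjunctive (res c d) \<or> res c d = no_res"
      using Cons.prems by (intro conjunctive_res) auto
    ultimately show ?case using Cons.IH[of "res c d"] Cons.prems by auto
  qed auto
  with assms show ?thesis by (cases cs) auto
qed

lemma foldl_glue: "foldl glue (glue R Q) Ts = glue R (foldl glue Q Ts)"
  by (induction Ts arbitrary: Q) (simp_all add: glue_assoc)

text \<open>\<open>res_seq\<close> brackets to the left, but \<open>glue\<close> is associative, so
  on ground instances a sequence can be cut anywhere.\<close>

lemma grnd_res_seq_append:
  assumes "cs \<noteq> []" "ds \<noteq> []" "\<forall>c\<in>set (cs @ ds). is_chc S P c"
  shows "grnd M (res_seq (cs @ ds)) = glue (grnd M (res_seq cs)) (grnd M (res_seq ds))"
proof -
  obtain c cs' where c: "cs = c # cs'" using assms(1) by (cases cs) auto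
  obtain d ds' where d: "ds = d # ds'" using assms(2) by (cases ds) auto
  have "\<forall>c\<in>set (c # (cs' @ d # ds')). is_chc S P c" "\<forall>c\<in>set (c # cs'). is_chc S P c"
    "\<forall>c\<in>set (d # ds'). is_chc S P c"
    using assms(3) c d by auto
  note this[THEN res_seq_Cons_chc_grnd, THEN conjunct2, of M]
  thus ?thesis by (simp add: c d foldl_glue)
qed

text \<open>Composition is monotone in both factors. Empty contexts are treated separately because
  \<open>res_seq []\<close> is unspecified.\<close>

lemma grnd_res_seq_replace:
  assumes "ys \<noteq> []" "ys' \<noteq> []" "\<forall>c\<in>set (xs @ ys @ ys' @ zs). is_chc S P c"
    and sub: "grnd M (res_seq ys) \<subseteq> grnd M (res_seq ys')"
  shows "grnd M (res_seq (xs @ ys @ zs)) \<subseteq> grnd M (res_seq (xs @ ys' @ zs))"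
proof -
  have 1: "grnd M (res_seq (ys @ zs)) \<subseteq> grnd M (res_seq (ys' @ zs))"
  proof (cases "zs = []")
    case False
    have "grnd M (res_seq (ys @ zs)) = glue (grnd M (res_seq ys)) (grnd M (res_seq zs))"
      "grnd M (res_seq (ys' @ zs)) = glue (grnd M (res_seq ys')) (grnd M (res_seq zs))"
      by ((rule grnd_res_seq_append[where S = S and P = P]; use assms(1-3) False in auto)+)
    thus ?thesis using glue_mono[OF sub] by auto
  qed (use sub in simp)
  show ?thesis
  proof (cases "xs = []")
    case False
    have "grnd M (res_seq (xs @ ys @ zs)) = glue (grnd M (res_seq xs)) (grnd M (res_seq (ys @ zs)))"
      "grnd M (res_seq (xs @ ys' @ zs)) = glue (grnd M (res_seq xs)) (grnd M (res_seq (ys' @ zs)))"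
      by ((rule grnd_res_seq_append[where S = S and P = P]; use assms(1-3) False in auto)+)
    thus ?thesis using glue_mono[OF _ 1] by auto
  qed (use 1 in simp)
qed


section \<open>Syntactic implicants\<close>

lemma finite_literals: "finite (literals \<phi>)"
  by (induction \<phi>) simp_all

lemma sat_conjunction: "is_conjunction \<chi> \<Longrightarrow> sat M v \<chi> \<longleftrightarrow> (\<forall>l\<in>literals \<chi>. sat M v l)"
  by (induction \<chi>) auto

lemma conjunction_qf_nnf:
  "is_conjunction \<chi> \<Longrightarrow> quantifier_free \<chi> \<and> nnf \<chi>"
proof (induction \<chi>)
  case (Neg \<chi>)
  thus ?case by (cases \<chi>) auto
qed auto

lemma literals_are_conjunctions:
  "nnf \<phi> \<Longrightarrow> l \<in> literals \<phi> \<Longrightarrow> is_conjunction l \<and> literals l = {l}"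
  by (induction \<phi>) auto

lemma well_sorted_literals: "well_sorted S \<phi> \<Longrightarrow> l \<in> literals \<phi> \<Longrightarrow> well_sorted S l"
  by (induction \<phi>) auto

lemma well_sorted_conjunction:
  "is_conjunction \<chi> \<Longrightarrow> \<forall>l\<in>literals \<chi>. well_sorted S l \<Longrightarrow> well_sorted S \<chi>"
  by (induction \<chi>) auto

text \<open>Implicants are described by sets of literals but represented by formulas, so a
  representative has to be built.\<close>

lemma ex_conjunction:
  assumes "finite L" "L \<subseteq> literals \<phi>" "nnf \<phi>"
  shows "\<exists>\<chi>. is_conjunction \<chi> \<and> literals \<chi> = L"
  using assms(1,2)
proof (induction L rule: finite_induct)
  case empty
  show ?case by (rule exI[of _ Top]) simp
next
  case (insert l L)
  then obtain \<chi> where "is_conjunction \<chi>" "literals \<chi> = L" by auto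
  moreover have "is_conjunction l" "literals l = {l}"
    using insert.prems literals_are_conjunctions[OF assms(3)] by auto
  ultimately show ?case by (intro exI[of _ "And l \<chi>"]) simp
qed

lemma sip_chc:
  assumes "chc_problem S P \<Pi>" "c \<in> sip M \<Pi>"
  shows "is_chc S P c" "conjunctive c"
proof -
  from assms(2) obtain d \<chi> v where d: "d \<in> \<Pi>" "c = Clause (body d) \<chi> (head d)"
    "is_conjunction \<chi>" "literals \<chi> = {l \<in> literals (cond d). sat M v l}"
    by (auto simp: sip_def sip_clause_def sip_fm_def sip_under_def)
  have "is_chc S P d" using assms(1) d(1) by (simp add: chc_problem_def)
  moreover from this have "well_sorted S \<chi>"
    using d(3,4) well_sorted_literals by (intro well_sorted_conjunction) (auto simp: is_chc_def)
  ultimately show "is_chc S P c" "conjunctive c"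
    using d(2,3) conjunction_qf_nnf by (auto simp: is_chc_def conjunctive_def)
qed

lemma sip_mono: "\<Pi> \<subseteq> \<Pi>' \<Longrightarrow> sip M \<Pi> \<subseteq> sip M \<Pi>'"
  by (auto simp: sip_def)

text \<open>The implicant under the very valuation that produces the ground instance is satisfied by
  it. Hence passing to implicants loses no ground instance.\<close>

lemma sip_covers:
  assumes "c \<in> \<Pi>" "is_chc S P c" "g \<in> grnd M c"
  shows "\<exists>d\<in>sip M \<Pi>. g \<in> grnd M d"
proof -
  from assms(3) obtain v where v: "valuation M v" "sat M v (cond c)"
    "g = (inst v (body c), inst v (head c))"
    by (auto simp: grnd_def)
  obtain \<chi> where \<chi>: "is_conjunction \<chi>" "literals \<chi> = {l \<in> literals (cond c). sat M v l}"
    using ex_conjunction[of "{l \<in> literals (cond c). sat M v l}" "cond c"] assms(2)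
    by (auto simp: is_chc_def finite_literals)
  have "Clause (body c) \<chi> (head c) \<in> sip M \<Pi>"
    using \<chi> v assms(1) by (auto simp: sip_def sip_clause_def sip_fm_def sip_under_def)
  moreover have "g \<in> grnd M (Clause (body c) \<chi> (head c))"
    using \<chi> v by (auto simp: grnd_def sat_conjunction)
  ultimately show ?thesis by blast
qed

text \<open>A valuation satisfying a conjunction satisfies all its literals, so the conjunction is
  an implicant of itself. This is what allows a learned clause to enter the trace.\<close>

lemma conjunctive_in_sip:
  assumes "c \<in> \<Pi>" "conjunctive c" "grnd M c \<noteq> {}"
  shows "c \<in> sip M \<Pi>"
proof -
  from assms(3) obtain v where v: "valuation M v" "sat M v (cond c)"
    by (auto simp: grnd_def)
  have "cond c \<in> sip_under M (cond c) v"
    using assms(2) v(2) sat_conjunction[of "cond c" M v]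
    by (auto simp: sip_under_def conjunctive_def)
  hence "Clause (body c) (cond c) (head c) \<in> sip M \<Pi>"
    using assms(1) v unfolding sip_def sip_clause_def sip_fm_def by blast
  thus ?thesis by simp
qed

text \<open>\<open>sip M \<Pi>\<close> may be infinite, as an implicant is represented by all
  conjunctions with the same literals. Its ground instances, however, depend only on a clause of
  \<open>\<Pi>\<close> and a subset of its finitely many literals.\<close>

lemma finite_grnd_sip:
  assumes "finite \<Pi>"
  shows "finite (grnd M ` sip M \<Pi>)"
proof -
  let ?G = "\<lambda>(c, L). {(inst v (body c), inst v (head c)) | v. valuation M v \<and> (\<forall>l\<in>L. sat M v l)}"
  have "grnd M ` sip M \<Pi> \<subseteq> ?G ` (SIGMA c:\<Pi>. Pow (literals (cond c)))"
  proof (rule image_subsetI)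
    fix c assume "c \<in> sip M \<Pi>"
    then obtain d \<chi> v where d: "d \<in> \<Pi>" "c = Clause (body d) \<chi> (head d)"
      "is_conjunction \<chi>" "literals \<chi> = {l \<in> literals (cond d). sat M v l}"
      by (auto simp: sip_def sip_clause_def sip_fm_def sip_under_def)
    have "grnd M c = ?G (d, literals \<chi>)"
      unfolding grnd_def d(2) by (simp add: sat_conjunction[OF d(3)])
    moreover have "(d, literals \<chi>) \<in> (SIGMA c:\<Pi>. Pow (literals (cond c)))"
      using d by auto
    ultimately show "grnd M c \<in> ?G ` (SIGMA c:\<Pi>. Pow (literals (cond c)))" by (rule image_eqI)
  qed
  thus ?thesis by (rule finite_subset) (simp add: assms finite_literals)
qed

lemma ex_maximal_sip:
  assumes "finite \<Pi>" "c \<in> sip M \<Pi>"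
  shows "\<exists>d\<in>sip M \<Pi>. grnd M c \<subseteq> grnd M d \<and> \<not> strictly_redundant M d (sip M \<Pi>)"
proof -
  obtain G where "G \<in> grnd M ` sip M \<Pi>" "grnd M c \<subseteq> G"
    "\<forall>G'\<in>grnd M ` sip M \<Pi>. G \<subseteq> G' \<longrightarrow> G = G'"
    using finite_has_maximal2[OF finite_grnd_sip[OF assms(1), of M], of "grnd M c"] assms(2)
    by auto
  thus ?thesis unfolding strictly_redundant_def by (auto simp: psubset_eq)
qed


section \<open>Ground refutations\<close>

text \<open>The pair \<open>(None, None)\<close> is the ground empty clause, i.e. truth implies
  falsity.\<close>

definition refutes ::
  "('f, 'r, 's, 'u) fo_structure \<Rightarrow> ('p, 'f, 'r, 's var) clause list \<Rightarrow> bool" where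
  "refutes M cs \<longleftrightarrow> cs \<noteq> [] \<and> (None, None) \<in> grnd M (res_seq cs)"

lemma refutes_imp_refutation: "refutes M cs \<Longrightarrow> refutation M cs"
  by (auto simp: refutes_def refutation_def grnd_def is_cond_empty_def satisfiable_fm_def)

lemma refutes_replace:
  assumes "refutes M (xs @ ys @ zs)" "ys \<noteq> []" "ys' \<noteq> []"
    and "\<forall>c\<in>set (xs @ ys @ ys' @ zs). is_chc S P c"
    and "grnd M (res_seq ys) \<subseteq> grnd M (res_seq ys')"
  shows "refutes M (xs @ ys' @ zs)"
  using grnd_res_seq_replace[OF assms(2-5)] assms(1,3) by (auto simp: refutes_def)

text \<open>A composition is nonempty only if its factors are. Along a refutation this gives the
  satisfiability demanded by \<open>active\<close>.\<close>

lemma refutes_prefix_nonempty: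
  assumes "refutes M (xs @ ys)" "xs \<noteq> []" "\<forall>c\<in>set (xs @ ys). is_chc S P c"
  shows "grnd M (res_seq xs) \<noteq> {}"
proof (cases "ys = []")
  case False
  show ?thesis
    using assms(1) grnd_res_seq_append[OF assms(2) False assms(3), of M]
    by (auto simp: refutes_def glue_def)
qed (use assms in \<open>auto simp: refutes_def\<close>)

lemma refutes_infix_nonempty:
  assumes "refutes M (xs @ ys @ zs)" "ys \<noteq> []" "\<forall>c\<in>set (xs @ ys @ zs). is_chc S P c"
  shows "grnd M (res_seq ys) \<noteq> {}"
proof -
  have "grnd M (res_seq (xs @ ys)) \<noteq> {}"
    using refutes_prefix_nonempty[of M "xs @ ys" zs S P] assms by simp
  thus ?thesis
    using grnd_res_seq_append[of xs ys S P M] assms(2,3) by (cases "xs = []") (auto simp: glue_def)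
qed

text \<open>Composition keeps the bodies of its first factor, so the first clause of a refutation
  has no body.\<close>

lemma refutes_starts_with_fact:
  assumes "refutes M (c # cs)" "\<forall>d\<in>set (c # cs). is_chc S P d"
  shows "is_fact c \<or> is_cond_empty c"
proof -
  have "\<exists>h. (None, h) \<in> grnd M c"
  proof (cases "cs = []")
    case False
    show ?thesis using grnd_res_seq_append[of "[c]" cs S P M] False assms
      by (auto simp: refutes_def glue_def)
  qed (use assms in \<open>auto simp: refutes_def\<close>)
  hence "body c = None" by (auto simp: grnd_def)
  thus ?thesis by (auto simp: is_fact_def is_cond_empty_def)
qed

text \<open>Otherwise, interpreting the predicates by the derivable ground atoms gives a model.
  Since clauses are linear, a derivation is just a sequence of clauses.\<close>

lemma unsatisfiable_imp_refutes:
  fixes M :: "('f, 'r, 's, 'u) fo_structure" and \<Phi> :: "('p, 'f, 'r, 's var) clause set"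
  assumes "chc_problem S P \<Phi>" "\<not> satisfiable M \<Phi>"
  shows "\<exists>cs. set cs \<subseteq> sip M \<Phi> \<and> refutes M cs"
proof (rule ccontr)
  assume no: "\<not> ?thesis"
  define derivable :: "('p \<times> 'u list) option \<Rightarrow> bool" where
    "derivable = (\<lambda>a. \<exists>cs. cs \<noteq> [] \<and> set cs \<subseteq> sip M \<Phi> \<and> (None, a) \<in> grnd M (res_seq cs))"
  \<comment> \<open>Derivability is closed under every clause of \<open>\<Phi>\<close>: a derivation
    of the body is extended by an implicant having the required ground instance.\<close>
  have step: "derivable (inst v (head c))"
    if "c \<in> \<Phi>" "valuation M v" "sat M v (cond c)" "body c = None \<or> derivable (inst v (body c))" for c v
  proof -
    have "(inst v (body c), inst v (head c)) \<in> grnd M c" using that by (auto simp: grnd_def)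
    then obtain d where d: "d \<in> sip M \<Phi>" "(inst v (body c), inst v (head c)) \<in> grnd M d"
      using sip_covers[OF \<open>c \<in> \<Phi>\<close>] assms(1) \<open>c \<in> \<Phi>\<close> unfolding chc_problem_def by blast
    show ?thesis
    proof (cases "body c = None")
      case True
      with d have "[d] \<noteq> [] \<and> set [d] \<subseteq> sip M \<Phi> \<and> (None, inst v (head c)) \<in> grnd M (res_seq [d])"
        by simp
      thus ?thesis unfolding derivable_def by blast
    next
      case False
      with that(4) obtain cs where cs: "cs \<noteq> []" "set cs \<subseteq> sip M \<Phi>"
        "(None, inst v (body c)) \<in> grnd M (res_seq cs)"
        by (auto simp: derivable_def)
      have "grnd M (res_seq (cs @ [d])) = glue (grnd M (res_seq cs)) (grnd M (res_seq [d]))"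
        using cs d(1) sip_chc[OF assms(1)] by (intro grnd_res_seq_append) auto
      moreover obtain m where "inst v (body c) = Some m"
        using False by (metis inst_eq_None not_None_eq)
      ultimately have "(None, inst v (head c)) \<in> grnd M (res_seq (cs @ [d]))"
        using cs(3) d(2) by (cases m) (auto simp: glue_def)
      thus ?thesis unfolding derivable_def using cs(2) d(1) by (intro exI[of _ "cs @ [d]"]) simp
    qed
  qed
  have none: "\<not> derivable None" using no by (auto simp: derivable_def refutes_def)
  have "clause_true M (\<lambda>F us. derivable (Some (F, us))) c" if "c \<in> \<Phi>" for c
    unfolding clause_true_def
  proof (intro allI impI, elim conjE)
    fix v
    assume v: "valuation M v" "sat M v (cond c)"
      and b: "case body c of None \<Rightarrow> True | Some (F, xs) \<Rightarrow> derivable (Some (F, map v xs))"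
    have "body c = None \<or> derivable (inst v (body c))"
      using b by (auto simp: inst_def split: option.splits)
    with step[OF that v] have "derivable (inst v (head c))" .
    thus "case head c of None \<Rightarrow> False | Some (G, ys) \<Rightarrow> derivable (Some (G, map v ys))"
      using none by (cases "head c") (auto simp: inst_def)
  qed
  with assms(2) show False unfolding satisfiable_def by blast
qed


section \<open>Optimal completions of a trace\<close>

text \<open>The last two conjuncts oppose the two ways of being covered: minimal length excludes
  covered blocks of several clauses, and maximality excludes strictly covered single
  clauses.\<close>

definition optimal_completion ::
  "('f, 'r, 's, 'u) fo_structure \<Rightarrow> ('p, 'f, 'r, 's var) clause set \<Rightarrow>
   ('p, 'f, 'r, 's var) clause list \<Rightarrow> ('p, 'f, 'r, 's var) clause list \<Rightarrow> bool" where
  "optimal_completion M \<Pi> t ds \<longleftrightarrow>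
     set ds \<subseteq> sip M \<Pi> \<and> refutes M (t @ ds) \<and>
     (\<forall>ds'. set ds' \<subseteq> sip M \<Pi> \<and> refutes M (t @ ds') \<longrightarrow> length ds \<le> length ds') \<and>
     (\<forall>d\<in>set ds. \<not> strictly_redundant M d (sip M \<Pi>))"

text \<open>Clauses are enlarged one by one from the left; each enlarged clause then moves into the
  fixed prefix \<open>t\<close>, which the induction generalizes.\<close>

lemma refutes_maximal:
  assumes \<Pi>: "chc_problem S P \<Pi>" and t: "\<forall>c\<in>set t. is_chc S P c"
  shows "set ds \<subseteq> sip M \<Pi> \<Longrightarrow> refutes M (t @ ds) \<Longrightarrow>
    \<exists>ds'. length ds' = length ds \<and> set ds' \<subseteq> sip M \<Pi> \<and> refutes M (t @ ds') \<and>
      (\<forall>d\<in>set ds'. \<not> strictly_redundant M d (sip M \<Pi>))"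
  using t
proof (induction ds arbitrary: t)
  case (Cons c ds)
  have "c \<in> sip M \<Pi>" "finite \<Pi>" using Cons.prems(1) \<Pi> by (auto simp: chc_problem_def)
  then obtain d where d: "d \<in> sip M \<Pi>" "grnd M c \<subseteq> grnd M d" "\<not> strictly_redundant M d (sip M \<Pi>)"
    using ex_maximal_sip by blast
  have "refutes M (t @ [d] @ ds)"
  proof (rule refutes_replace)
    show "\<forall>c\<in>set (t @ [c] @ [d] @ ds). is_chc S P c"
      using Cons.prems(1,3) d(1) sip_chc(1)[OF \<Pi>] by auto
  qed (use Cons.prems(2) d(2) in simp_all)
  moreover have "\<forall>c\<in>set (t @ [d]). is_chc S P c"
    using Cons.prems(3) d(1) sip_chc(1)[OF \<Pi>] by auto
  ultimately obtain ds' where ds': "length ds' = length ds" "set ds' \<subseteq> sip M \<Pi>"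
    "refutes M ((t @ [d]) @ ds')" "\<forall>d\<in>set ds'. \<not> strictly_redundant M d (sip M \<Pi>)"
    using Cons.IH[of "t @ [d]"] Cons.prems(1) by auto
  show ?case
    using ds' d by (intro exI[of _ "d # ds'"]) simp
qed simp

lemma ex_optimal_completion:
  assumes \<Pi>: "chc_problem S P \<Pi>" and t: "\<forall>c\<in>set t. is_chc S P c"
    and ds: "set ds \<subseteq> sip M \<Pi>" "refutes M (t @ ds)"
  shows "\<exists>ds'. optimal_completion M \<Pi> t ds' \<and> length ds' \<le> length ds"
proof -
  obtain es where es: "set es \<subseteq> sip M \<Pi> \<and> refutes M (t @ es)"
    "\<forall>es'. set es' \<subseteq> sip M \<Pi> \<and> refutes M (t @ es') \<longrightarrow> length es \<le> length es'"
    using ex_has_least_nat[of "\<lambda>es. set es \<subseteq> sip M \<Pi> \<and> refutes M (t @ es)" ds length] ds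
    by blast
  with refutes_maximal[OF \<Pi> t, of es M] obtain ds' where
    "length ds' = length es" "set ds' \<subseteq> sip M \<Pi>" "refutes M (t @ ds')"
    "\<forall>d\<in>set ds'. \<not> strictly_redundant M d (sip M \<Pi>)"
    by blast
  thus ?thesis using es ds unfolding optimal_completion_def by (intro exI[of _ ds']) auto
qed

lemma optimal_completion_not_covered:
  assumes \<Pi>: "chc_problem S P \<Pi>" and t: "\<forall>c\<in>set t. is_chc S P c"
    and opt: "optimal_completion M \<Pi> t (xs @ ys @ zs)"
  shows "\<not> covered M \<Pi> ys"
proof
  assume cov: "covered M \<Pi> ys"
  have sip: "set (xs @ ys @ zs) \<subseteq> sip M \<Pi>" and ref: "refutes M (t @ xs @ ys @ zs)"
    and min: "\<And>ds'. set ds' \<subseteq> sip M \<Pi> \<Longrightarrow> refutes M (t @ ds') \<Longrightarrow>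
      length (xs @ ys @ zs) \<le> length ds'"
    and max: "\<And>d. d \<in> set (xs @ ys @ zs) \<Longrightarrow> \<not> strictly_redundant M d (sip M \<Pi>)"
    using opt unfolding optimal_completion_def by blast+
  have ys: "ys \<noteq> []" using cov by (simp add: covered_def)
  show False
  \<comment> \<open>A longer block could be replaced by the single clause covering it, against
    minimal length. For a single clause only strict redundancy counts as covered, against
    maximality.\<close>
  proof (cases "length ys > 1")
    case True
    with cov obtain d where d: "d \<in> sip M \<Pi>" "grnd M (res_seq ys) \<subseteq> grnd M d"
      by (auto simp: covered_def redundant_def strictly_redundant_def)
    have "refutes M ((t @ xs) @ [d] @ zs)"
    proof (rule refutes_replace)
      show "\<forall>c\<in>set ((t @ xs) @ ys @ [d] @ zs). is_chc S P c"
        using sip t d(1) sip_chc(1)[OF \<Pi>] by auto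
    qed (use ref ys d(2) in simp_all)
    hence "length (xs @ ys @ zs) \<le> length (xs @ [d] @ zs)"
      using sip d(1) by (intro min) auto
    with True show False by simp
  next
    case False
    with ys obtain d where "ys = [d]" by (cases ys) auto
    with cov max show False by (simp add: covered_def)
  qed
qed


section \<open>Completeness\<close>

lemma grnd_accel:
  assumes acc: "acceleration_technique S P M accel"
    and c: "is_chc S P c" "recursive c" "conjunctive c"
  shows "grnd M c \<subseteq> grnd M (accel c)"
    and "glue (grnd M (accel c)) (grnd M (accel c)) \<subseteq> grnd M (accel c)"
proof -
  have eq: "grnd M (accel c) = (\<Union>n\<in>{1..}. grnd M (res_seq (replicate n c)))"
    using acc c unfolding acceleration_technique_def by blast
  have "grnd M (res_seq (replicate 1 c)) \<subseteq> grnd M (accel c)"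
    unfolding eq by (intro UN_upper) simp
  thus "grnd M c \<subseteq> grnd M (accel c)" by simp
  show "glue (grnd M (accel c)) (grnd M (accel c)) \<subseteq> grnd M (accel c)"
  proof
    fix g assume "g \<in> glue (grnd M (accel c)) (grnd M (accel c))"
    then obtain n m where nm: "n \<ge> 1" "m \<ge> 1"
      "g \<in> glue (grnd M (res_seq (replicate n c))) (grnd M (res_seq (replicate m c)))"
      unfolding eq glue_def by blast
    \<comment> \<open>Composing the \<open>n\<close>-th and the \<open>m\<close>-th power gives the
      power \<open>n + m\<close>.\<close>
    have "grnd M (res_seq (replicate n c @ replicate m c)) =
      glue (grnd M (res_seq (replicate n c))) (grnd M (res_seq (replicate m c)))"
      using nm(1,2) c(1) by (intro grnd_res_seq_append) auto
    hence "g \<in> grnd M (res_seq (replicate (n + m) c))"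
      using nm(3) by (simp add: replicate_add)
    thus "g \<in> grnd M (accel c)" unfolding eq using nm(1) by auto
  qed
qed

text \<open>All powers of a transitive relation lie in the relation. Thus accelerating a learned
  clause once more is redundant.\<close>

lemma grnd_accel_transitive:
  assumes acc: "acceleration_technique S P M accel"
    and c: "is_chc S P c" "recursive c" "conjunctive c"
    and trans: "glue (grnd M c) (grnd M c) \<subseteq> grnd M c"
  shows "grnd M (accel c) \<subseteq> grnd M c"
proof -
  have "grnd M (res_seq (replicate (Suc n) c)) \<subseteq> grnd M c" for n
  proof (induction n)
    case (Suc n)
    have "grnd M (res_seq ([c] @ replicate (Suc n) c)) =
      glue (grnd M (res_seq [c])) (grnd M (res_seq (replicate (Suc n) c)))"
      using c(1) by (intro grnd_res_seq_append) auto
    also have "\<dots> \<subseteq> glue (grnd M c) (grnd M c)" using Suc by (intro glue_mono) auto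
    finally show ?case using trans by simp
  qed simp
  moreover have "grnd M (accel c) = (\<Union>n\<in>{1..}. grnd M (res_seq (replicate n c)))"
    using acc c unfolding acceleration_technique_def by blast
  ultimately show ?thesis by (auto simp: Suc_le_eq gr0_conv_Suc) blast
qed

text \<open>
  The trace consists of the part \<^term>\<open>t\<close> up to the last acceleration and the steps \<^term>\<open>es\<close>
  made since then, and \<^term>\<open>rs\<close> are the steps still to be made. The last component of the
  measure of the induction is needed for the acceleration of a single clause, which changes no
  length; it cannot be repeated, since accelerating a transitive clause is redundant.
\<close>

lemma derivation_completes:
  fixes accel :: "('p, 'f, 'r, 's var) clause \<Rightarrow> ('p, 'f, 'r, 's var) clause"
  assumes acc: "acceleration_technique S P M accel"
    and "rs_derivation S P M accel \<Phi> h" "last h = State \<Pi> (t @ es) Bs"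
    and "is_state S P M \<Phi> (State \<Pi> (t @ es) Bs)"
    and "optimal_completion M \<Pi> t (es @ rs)"
    and "last Bs = {} \<or> es = [] \<and> t \<noteq> [] \<and> last Bs = {last t} \<and>
      glue (grnd M (last t)) (grnd M (last t)) \<subseteq> grnd M (last t)"
    and "\<forall>\<Pi>' cs' Bs'. State \<Pi>' cs' Bs' \<in> set h \<longrightarrow>
      \<Pi>' \<subseteq> \<Pi> \<and> (\<Pi>' = \<Pi> \<longrightarrow> length t \<le> length cs')"
  shows "rs_reaches S P M accel \<Phi> Unsat"
  using assms(2-)
\<comment> \<open>Accelerating several clauses decreases the total length; a step keeps it but moves
  a clause out of \<open>rs\<close>.\<close>
proof (induction "(length (t @ es @ rs), length rs,
      if t @ es = [] \<or> redundant M (accel (last (t @ es))) (sip M \<Pi>) then 0 else 1 :: nat)"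
    arbitrary: h \<Pi> t es Bs rs
    rule: wf_induct_rule[OF wf_lex_prod[OF wf_less_than wf_lex_prod[OF wf_less_than wf_less_than]]])
  case (1 \<Pi> t es rs h Bs)
  note der = 1(2) and last = 1(3) and state = 1(4) and opt = 1(5) and Bs = 1(6) and hist = 1(7)
  have \<Pi>: "chc_problem S P \<Pi>" and len: "length Bs = length (t @ es) + 1"
    and trace: "set (t @ es) \<subseteq> sip M \<Pi>" and BsS: "\<forall>B\<in>set Bs. B \<subseteq> sip M \<Pi>" and \<Phi>\<Pi>: "\<Phi> \<subseteq> \<Pi>"
    using state by auto
  have all: "set (t @ es @ rs) \<subseteq> sip M \<Pi>" and ref: "refutes M (t @ es @ rs)"
    using opt trace by (auto simp: optimal_completion_def)
  have chc: "\<forall>c\<in>set (t @ es @ rs). is_chc S P c \<and> conjunctive c"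
    using all sip_chc[OF \<Pi>] by blast
  have no_cover: "\<not> must_cover M h"
  proof
    assume "must_cover M h"
    then obtain cs Bs0 ds where c: "State \<Pi> cs Bs0 \<in> set (butlast h)"
      "t @ es = cs @ ds" "covered M \<Pi> ds"
      using last unfolding must_cover_def by auto
    \<comment> \<open>An earlier state with the same clause set already had a trace at least as long
      as \<open>t\<close>, so the covered suffix lies inside \<open>es\<close> and is a part of the
      optimal completion.\<close>
    have "length t \<le> length cs" using hist in_set_butlastD[OF c(1)] by blast
    with c(2) obtain us where "es = us @ ds"
      by (auto simp: append_eq_append_conv2)
    with opt have "optimal_completion M \<Pi> t (us @ ds @ rs)" by simp
    moreover have "\<forall>c\<in>set t. is_chc S P c" using chc by simp
    ultimately show False
      using optimal_completion_not_covered[OF \<Pi>] c(3) by blast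
  qed
  show ?case
  proof (cases rs)
    case Nil
    have "adcl S P M accel \<Phi> Refute (last h) Unsat"
      using state last Nil ref by (auto simp: adcl_def intro!: refuted refutes_imp_refutation)
    moreover have "reasonable M accel h Refute"
      using no_cover by (simp add: reasonable_def)
    ultimately have "rs_derivation S P M accel \<Phi> (h @ [Unsat])"
      using der extend by blast
    thus ?thesis unfolding rs_reaches_def by (metis last_snoc)
  next
    case (Cons c rs')
    show ?thesis
    \<comment> \<open>The strategy admits Step only if there is no candidate for acceleration, and
      Accelerate only on a shortest candidate.\<close>
    proof (cases "\<exists>ds. acceleration_candidate M accel \<Pi> (t @ es) ds")
      case True
      then obtain ds where cand: "acceleration_candidate M accel \<Pi> (t @ es) ds"
        and least: "\<forall>ds'. acceleration_candidate M accel \<Pi> (t @ es) ds' \<longrightarrow> length ds \<le> length ds'"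
        using ex_has_least_nat[of "acceleration_candidate M accel \<Pi> (t @ es)" _ length] by metis
      from cand obtain bs where ds: "ds \<noteq> []" "t @ es = bs @ ds" "recursive (res_seq ds)"
        "\<not> redundant M (accel (res_seq ds)) (sip M \<Pi>)"
        unfolding acceleration_candidate_def by blast
      define a where "a = accel (res_seq ds)"
      let ?\<Pi> = "\<Pi> \<union> {a}"
      have chc_ds: "\<forall>c\<in>set (bs @ ds @ rs). is_chc S P c \<and> conjunctive c"
        using chc ds(2) by (metis append.assoc)
      have ref': "refutes M (bs @ ds @ rs)" using ref ds(2) by (metis append.assoc)
      have r: "is_chc S P (res_seq ds)" using ds(1) chc_ds by (intro is_chc_res_seq) auto
      \<comment> \<open>Being recursive, the resolvent is not the default clause.\<close>
      have rc: "conjunctive (res_seq ds)"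
        using ds(1) chc_ds ds(3) by (intro conjunctive_res_seq) (auto simp: recursive_def)
      have a: "is_chc S P a" "recursive a" "conjunctive a"
        using acc r ds(3) rc unfolding acceleration_technique_def a_def by blast+
      have sub: "grnd M (res_seq ds) \<subseteq> grnd M a"
        and trans: "glue (grnd M a) (grnd M a) \<subseteq> grnd M a"
        unfolding a_def using grnd_accel[OF acc r ds(3) rc] by blast+
      have "grnd M (res_seq ds) \<noteq> {}"
        using refutes_infix_nonempty[OF ref' ds(1)] chc_ds by blast
      with sub have ne: "grnd M a \<noteq> {}" by blast
      have a_sip: "a \<in> sip M ?\<Pi>" using conjunctive_in_sip[OF _ a(3) ne] by simp
      \<comment> \<open>If \<open>a\<close> were in \<open>\<Pi>\<close>, it would be its own
        implicant and hence redundant. So the clause set grows properly.\<close>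
      have a_new: "a \<notin> \<Pi>"
        using conjunctive_in_sip[OF _ a(3) ne, of \<Pi>] ds(4) by (auto simp: redundant_def a_def)
      have mono: "sip M \<Pi> \<subseteq> sip M ?\<Pi>" by (intro sip_mono) auto
      have \<Pi>': "chc_problem S P ?\<Pi>" using \<Pi> a(1) by (auto simp: chc_problem_def)
      \<comment> \<open>There is one more blocking set than there are trace clauses, hence the
        \<open>+ 1\<close>.\<close>
      define B1 where "B1 = take (length bs + 1) Bs"
      define D where "D = drop (length bs + 1) Bs"
      have B: "Bs = B1 @ D" "length D = length ds" "length B1 = length bs + 1"
        using len ds(2) by (simp_all add: B1_def D_def)
      let ?s = "State ?\<Pi> (bs @ [a]) (B1 @ [{a}])"
      have state': "is_state S P M \<Phi> ?s"
        using \<Pi>' \<Phi>\<Pi> B BsS trace ds(2) mono a_sip by auto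
      have "apply_rule M accel (Accelerate ds) (State \<Pi> (bs @ ds) (B1 @ D)) ?s"
        using ds B a_def by (intro accelerate) auto
      hence "adcl S P M accel \<Phi> (Accelerate ds) (last h) ?s"
        using state state' last ds(2) B(1) by (simp add: adcl_def)
      moreover have "reasonable M accel h (Accelerate ds)"
        using no_cover last cand least by (auto simp: reasonable_def)
      ultimately have der': "rs_derivation S P M accel \<Phi> (h @ [?s])"
        using der extend by blast
      have "refutes M (bs @ [a] @ rs)"
      proof (rule refutes_replace[OF ref' ds(1)])
        show "\<forall>c\<in>set (bs @ ds @ [a] @ rs). is_chc S P c" using chc_ds a(1) by auto
      qed (use sub in simp_all)
      moreover have "\<forall>c\<in>set (bs @ [a]). is_chc S P c" using chc_ds a(1) by auto
      moreover have "set rs \<subseteq> sip M ?\<Pi>" using all mono by auto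
      ultimately obtain rs2 where rs2: "optimal_completion M ?\<Pi> (bs @ [a]) rs2"
        "length rs2 \<le> length rs"
        using ex_optimal_completion[OF \<Pi>', of "bs @ [a]" rs M] by auto
      have red: "redundant M (accel a) (sip M ?\<Pi>)"
        using grnd_accel_transitive[OF acc a trans] a_sip by (auto simp: redundant_def)
      \<comment> \<open>A single accelerated clause is the last one of the trace, and its
        acceleration was not redundant; by \<open>red\<close> the flag thus drops from 1 to
        0.\<close>
      have flag: "\<not> (t @ es = [] \<or> redundant M (accel (last (t @ es))) (sip M \<Pi>))"
        if "length ds = 1"
        using that ds by (auto simp: length_Suc_conv)
      have len': "length (t @ es @ rs) = length bs + length ds + length rs"
        using arg_cong[OF ds(2), of length] by simp
      show ?thesis
      proof (rule 1(1)[OF _ der', of "bs @ [a]" "[]" rs2])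
        show "((length ((bs @ [a]) @ [] @ rs2), length rs2,
            if (bs @ [a]) @ [] = [] \<or> redundant M (accel (last ((bs @ [a]) @ []))) (sip M ?\<Pi>)
            then 0 else 1),
          length (t @ es @ rs), length rs,
            if t @ es = [] \<or> redundant M (accel (last (t @ es))) (sip M \<Pi>) then 0 else 1)
          \<in> less_than <*lex*> less_than <*lex*> less_than"
          unfolding len' using rs2(2) red flag ds(1)
          by (cases "length ds = 1") (auto simp: le_less Suc_lessI)
        show "\<forall>\<Pi>' cs' Bs'. State \<Pi>' cs' Bs' \<in> set (h @ [?s]) \<longrightarrow>
          \<Pi>' \<subseteq> ?\<Pi> \<and> (\<Pi>' = ?\<Pi> \<longrightarrow> length (bs @ [a]) \<le> length cs')"
          \<comment> \<open>Clause sets of earlier states lie in \<open>\<Pi>\<close> and so lack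
            \<open>a\<close>; only the new state has the clause set
            \<open>\<Pi> \<union> {a}\<close>.\<close>
          using hist a_new by fastforce
      qed (use state' rs2 trans in auto)
    next
      case False
      let ?s = "State \<Pi> (t @ es @ [c]) (Bs @ [{}])"
      have c: "c \<in> sip M \<Pi>" using all Cons by simp
      have "\<not> redundant M c (last Bs)"
      proof
        assume redundant: "redundant M c (last Bs)"
        \<comment> \<open>The last blocking set is nonempty only right after an acceleration, where
          it contains just the learned clause \<open>last t\<close>.\<close>
        with Bs have B: "es = []" "t \<noteq> []" "grnd M c \<subseteq> grnd M (last t)"
          "glue (grnd M (last t)) (grnd M (last t)) \<subseteq> grnd M (last t)"
          by (auto simp: redundant_def)
        let ?l = "last t"
        have t: "t = butlast t @ [?l]" using B(2) by simp
        have chc_l: "\<forall>d\<in>set (butlast t @ [?l, c] @ [?l] @ rs'). is_chc S P d"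
          using chc Cons B(2) by (auto dest: in_set_butlastD)
        have "grnd M (res_seq ([?l] @ [c])) = glue (grnd M (res_seq [?l])) (grnd M (res_seq [c]))"
          using chc_l by (intro grnd_res_seq_append) auto
        also have "\<dots> \<subseteq> glue (grnd M ?l) (grnd M ?l)"
          using B(3) by (intro glue_mono) auto
        also have "\<dots> \<subseteq> grnd M ?l" by (rule B(4))
        \<comment> \<open>By transitivity the learned clause absorbs \<open>c\<close>, so
          \<open>rs'\<close> would be a shorter completion.\<close>
        finally have "grnd M (res_seq [?l, c]) \<subseteq> grnd M (res_seq [?l])" by simp
        moreover have "refutes M (butlast t @ [?l, c] @ rs')"
          using ref Cons B(1) t by (metis append.assoc append_Cons append_Nil)
        ultimately have "refutes M (butlast t @ [?l] @ rs')"
          using refutes_replace[OF _ _ _ chc_l] by blast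
        hence "refutes M (t @ rs')" using t by (metis append.assoc)
        hence "length (es @ rs) \<le> length rs'"
          using opt all Cons unfolding optimal_completion_def by auto
        thus False using Cons by simp
      qed
      moreover have "grnd M (res_seq (t @ es @ [c])) \<noteq> {}"
        using refutes_prefix_nonempty[of M "t @ es @ [c]" rs' S P] ref chc Cons by auto
      ultimately have "active M (t @ es) Bs c"
        by (simp add: active_def satisfiable_fm_iff_grnd)
      hence "apply_rule M accel (Step c) (State \<Pi> (t @ es) Bs) ?s"
        using step[OF c, of "t @ es" Bs] by simp
      moreover have state': "is_state S P M \<Phi> ?s"
        using state c by auto
      ultimately have "adcl S P M accel \<Phi> (Step c) (last h) ?s"
        using state last by (simp add: adcl_def)
      \<comment> \<open>With an empty trace, \<open>c\<close> is the first clause of the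
        refutation.\<close>
      moreover have "is_fact c \<or> is_cond_empty c" if "t @ es = []"
        using refutes_starts_with_fact[of M c rs' S P] ref chc Cons that by auto
      hence "reasonable M accel h (Step c)"
        using no_cover last False by (auto simp: reasonable_def)
      ultimately have der': "rs_derivation S P M accel \<Phi> (h @ [?s])"
        using der extend by blast
      show ?thesis
      proof (rule 1(1)[OF _ der', of t "es @ [c]" rs'])
        show "\<forall>\<Pi>' cs' Bs'. State \<Pi>' cs' Bs' \<in> set (h @ [?s]) \<longrightarrow>
          \<Pi>' \<subseteq> \<Pi> \<and> (\<Pi>' = \<Pi> \<longrightarrow> length t \<le> length cs')"
          using hist by auto
      qed (use state' opt Cons in auto)
    qed
  qed
qed

theorem theorem15:
  fixes S :: "('f, 'r, 's::countable) signature"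
    and P :: "'p \<rightharpoonup> 's list"
    and A :: "('f, 'r, 's var) fm set"
    and M :: "('f, 'r, 's, ('f, 's var) trm) fo_structure"
    and accel :: "('p, 'f, 'r, 's var) clause \<Rightarrow> ('p, 'f, 'r, 's var) clause"
    and \<Phi> :: "('p, 'f, 'r, 's var) clause set"
  assumes "complete_theory S A"
    and "ground_term_model S A M"
    and "acceleration_technique S P M accel"
    and "chc_problem S P \<Phi>"
    and "\<not> satisfiable M \<Phi>"
  shows "rs_reaches S P M accel \<Phi> Unsat"
proof -
  obtain cs where "set cs \<subseteq> sip M \<Phi>" "refutes M cs"
    using unsatisfiable_imp_refutes[OF assms(4,5)] by blast
  then obtain rs where rs: "optimal_completion M \<Phi> [] rs"
    using ex_optimal_completion[OF assms(4), of "[]" cs M] by auto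
  let ?s = "State \<Phi> [] [{}]"
  have state: "is_state S P M \<Phi> ?s" using assms(4) by simp
  have "adcl S P M accel \<Phi> Init (last [Input \<Phi>]) ?s"
    using state by (simp add: adcl_def apply_rule.init)
  moreover have "reasonable M accel [Input \<Phi>] Init"
    by (simp add: reasonable_def must_cover_def)
  ultimately have "rs_derivation S P M accel \<Phi> ([Input \<Phi>] @ [?s])"
    using start extend by blast
  thus ?thesis
    \<comment> \<open>No acceleration has taken place yet, so the part up to the last one is
      empty.\<close>
    by (rule derivation_completes[OF assms(3), where t = "[]" and es = "[]" and rs = rs])
      (use state rs in auto)
qed

end
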